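(* Let $(X_t)_{t\ge1}$ be a sequence of random variables such that, for constants $\mu,\sigma^2$ and all $t\ge 1$, $X_t\in[0,1]$, $\mathbb{E}_{t-1}X_t=\mu$, $\mathbb{V}_{t-1}X_t=\sigma^2$, and such that $\mathbb{V}_{t-1}[(X_t-\mu)^2]$ is constant across $t$ (denote the constant by $\mathbb{V}[(X_i-\mu)^2]$). Let $\alpha\in(0,1)$ and, for $n\ge3$, $$\alpha_{1,n}=\frac{1}{\log n}\alpha,\qquad \alpha_{2,n}=\frac{\log(n)-1}{\log(n)}\alpha .$$ Let the estimators $\widehat\mu_i,\widehat\sigma_i^2,\widehat m_{4,i}^2$ and the plug-ins $\lambda^{(n)}_{i,\delta},\tilde\lambda_i$ be as in the context (with $\widehat\mu$ of either form (A) or (B), and $c_2\wedge c_3>0$). Let $U_n$ denote the upper confidence limit at sample size $n$ and level $\alpha$ computed with plug-ins $\lambda^{(n)}_{i,\alpha}$, and let $L_n$ denote the lower confidence limit at sample size $n$ with error split $(\alpha_{1,n},\alpha_{2,n})$ computed with plug-ins $\lambda^{(n)}_{i,\alpha_{2,n}}$, as defined in the context; in each case $D_n$ is the center computed with the same plug-ins. Then, almost surely as $n\to\infty$, $$\sqrt n\,(U_n-D_n)\to\sqrt{2\,\mathbb{V}[(X_i-\mu)^2]\log(1/\alpha)},\qquad \sqrt n\,(D_n-L_n)\to\sqrt{2\,\mathbb{V}[(X_i-\mu)^2]\log(1/\alpha)}.$$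
   Context: All random variables live on a common probability space. $\mathcal{F}_t=\sigma(X_1,\dots,X_t)$ is the canonical filtration, with $\mathcal{F}_0$ trivial; $\mathbb{E}_t[\cdot]=\mathbb{E}[\cdot\mid\mathcal{F}_t]$, $\mathbb{V}_t[\cdot]=\mathbb{V}[\cdot\mid\mathcal{F}_t]$. Relations between random variables hold almost surely. $a\wedge b=\min(a,b)$. $\psi_E(\lambda)=-\log(1-\lambda)-\lambda$ for $\lambda\in[0,1)$, $\psi_P(\lambda)=\exp(\lambda)-\lambda-1$ for $\lambda\ge0$. Estimators. Fix constants $c_1\in(0,1)$, $c_2,c_3\in(0,1]$, $c_4\in[0,1]$, $c_5\in(0,\infty)$. For $t\ge1$, $$\bar\mu_t=\frac{c_4+\sum_{i\le t-1}X_i}{t},\quad \widehat\sigma_t^2=\frac{c_3+\sum_{i\le t-1}(X_i-\bar\mu_i)^2}{t},\quad \tilde\lambda_t=\sqrt{\frac{2\log(2/\alpha)}{\widehat\sigma_t^2\,t\log(1+t)}}\wedge c_5.$$ The mean estimator is either (A) $\widehat\mu_t=\bar\mu_t$ for all $t\ge1$, or (B) $\widehat\mu_1=\frac12$ and $\widehat\mu_t=\frac{\sum_{i=1}^{t-1}\tilde\lambda_iX_i}{\sum_{i=1}^{t-1}\tilde\lambda_i}$ for $t\ge2$. Further, $$\widehat m_{4,t}^2=\frac{c_2+\sum_{i\le t-1}\left[(X_i-\widehat\mu_i)^2-\widehat\sigma_i^2\right]^2}{t},\qquad \lambda^{(n)}_{t,\delta}=\sqrt{\frac{2\log(1/\delta)}{\widehat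 m_{4,t}^2\,n}}\wedge c_1\quad(1\le t\le n).$$ Confidence limits. For plug-ins $\lambda_1,\dots,\lambda_n$, $$D_n=\frac{\sum_{i\le n}\lambda_i(X_i-\widehat\mu_i)^2}{\sum_{i\le n}\lambda_i},\qquad R_{n,\delta}=\frac{\log(1/\delta)+\sum_{i\le n}\psi_E(\lambda_i)\left((X_i-\widehat\mu_i)^2-\widehat\sigma_i^2\right)^2}{\sum_{i\le n}\lambda_i}.$$ With $\lambda_i=\lambda^{(n)}_{i,\alpha}$: $U_n=D_n+R_{n,\alpha}$. With $\lambda_i=\lambda^{(n)}_{i,\alpha_{2,n}}$: $$L_n=\frac{-C^{(1)}_{n,\alpha_{1,n}}+\sqrt{\left(C^{(1)}_{n,\alpha_{1,n}}\right)^2+4C^{(2)}_n\left(D_n-C^{(0)}_{n,\alpha_{1,n}}-R_{n,\alpha_{2,n}}\right)}}{2C^{(2)}_n}$$ (set to $-\infty$ if the quantity under the square root is negative), where $$C^{(2)}_n=\frac{\sum_{i\le n}\lambda_i\tilde C^{(2)}_i}{\sum_{i\le n}\lambda_i},\quad C^{(1)}_{n,\delta}=1+\frac{\sum_{i\le n}\lambda_i\tilde C^{(1)}_{i,\delta}}{\sum_{i\le n}\lambda_i},\quad C^{(0)}_{n,\delta}=\frac{\sum_{i\le n}\lambda_i\tilde C^{(0)}_{i,\delta}}{\sum_{i\le n}\lambda_i},$$ and for $t\ge2$ $$\tilde C^{(2)}_t=\frac{\left(\sum_{i=1}^{t-1}\psi_P(\tilde\lambda_i)\right)^2}{\left(\sum_{i=1}^{t-1}\tilde\lambda_i\right)^2},\quad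 \tilde C^{(1)}_{t,\delta}=\frac{2\log(2/\delta)\sum_{i=1}^{t-1}\psi_P(\tilde\lambda_i)}{\left(\sum_{i=1}^{t-1}\tilde\lambda_i\right)^2},\quad \tilde C^{(0)}_{t,\delta}=\frac{\log^2(2/\delta)}{\left(\sum_{i=1}^{t-1}\tilde\lambda_i\right)^2},$$ with $\tilde C^{(2)}_1=\tilde C^{(1)}_{1,\delta}=0$, $\tilde C^{(0)}_{1,\delta}=\frac14$. *)

theory Defs
  imports "HOL-Probability.Probability"
begin

definition psiE :: "real \<Rightarrow> real" where
  "psiE l = - ln (1 - l) - l"

definition psiP :: "real \<Rightarrow> real" where
  "psiP l = exp l - l - 1"

text \<open>The \<sigma>-algebra generated by \<open>X 1, \<dots>, X t\<close>; for \<open>t = 0\<close> it is trivial.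
  The measure it carries is irrelevant: conditional expectations only use its space and sets.\<close>

definition hist :: "'a measure \<Rightarrow> (nat \<Rightarrow> 'a \<Rightarrow> real) \<Rightarrow> nat \<Rightarrow> 'a measure" where
  "hist M X t = sigma (space M) (\<Union>i\<in>{1..t}. {X i -` B \<inter> space M | B. B \<in> sets borel})"

definition cond_var :: "'a measure \<Rightarrow> 'a measure \<Rightarrow> ('a \<Rightarrow> real) \<Rightarrow> 'a \<Rightarrow> real" where
  "cond_var M F Y = real_cond_exp M F (\<lambda>w. (Y w - real_cond_exp M F Y w)\<^sup>2)"

record tuning =
  c1 :: real
  c2 :: real
  c3 :: real
  c4 :: real
  c5 :: real

definition admissible :: "tuning \<Rightarrow> bool" where
  "admissible c \<longleftrightarrow> 0 < c1 c \<and> c1 c < 1 \<and> 0 < c2 c \<and> c2 c \<le> 1 \<and> 0 < c3 c \<and> c3 c \<le> 1 \<and>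
     0 \<le> c4 c \<and> c4 c \<le> 1 \<and> 0 < c5 c"

datatype mean_form = Form_A | Form_B

text \<open>The estimators are functions of one observed path \<open>x\<close>, indexed from \<open>1\<close>
  (\<open>x 0\<close> is never used).  Only their values at times \<open>t \<ge> 1\<close> are meaningful.\<close>

definition mu_bar :: "tuning \<Rightarrow> (nat \<Rightarrow> real) \<Rightarrow> nat \<Rightarrow> real" where
  "mu_bar c x t = (c4 c + (\<Sum>i\<in>{1..<t}. x i)) / real t"

definition sigma2_hat :: "tuning \<Rightarrow> (nat \<Rightarrow> real) \<Rightarrow> nat \<Rightarrow> real" where
  "sigma2_hat c x t = (c3 c + (\<Sum>i\<in>{1..<t}. (x i - mu_bar c x i)\<^sup>2)) / real t"

definition lam_tilde :: "tuning \<Rightarrow> real \<Rightarrow> (nat \<Rightarrow> real) \<Rightarrow> nat \<Rightarrow> real" where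
  "lam_tilde c \<alpha> x t =
     min (sqrt (2 * ln (2 / \<alpha>) / (sigma2_hat c x t * real t * ln (1 + real t)))) (c5 c)"

fun mu_hat :: "mean_form \<Rightarrow> tuning \<Rightarrow> real \<Rightarrow> (nat \<Rightarrow> real) \<Rightarrow> nat \<Rightarrow> real" where
  "mu_hat Form_A c \<alpha> x t = mu_bar c x t"
| "mu_hat Form_B c \<alpha> x t =
     (if t = 1 then 1 / 2
      else (\<Sum>i\<in>{1..<t}. lam_tilde c \<alpha> x i * x i) / (\<Sum>i\<in>{1..<t}. lam_tilde c \<alpha> x i))"

text \<open>\<open>m4sq_hat\<close> is the squared quantity \<open>m\<^sub>4\<^sup>2\<close>, an estimate of the variance of \<open>(X - \<mu>)\<^sup>2\<close>.\<close>

definition m4sq_hat :: "mean_form \<Rightarrow> tuning \<Rightarrow> real \<Rightarrow> (nat \<Rightarrow> real) \<Rightarrow> nat \<Rightarrow> real" where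
  "m4sq_hat f c \<alpha> x t =
     (c2 c + (\<Sum>i\<in>{1..<t}. ((x i - mu_hat f c \<alpha> x i)\<^sup>2 - sigma2_hat c x i)\<^sup>2)) / real t"

text \<open>In what follows \<open>\<alpha>\<close> is the overall level (it enters through \<open>lam_tilde\<close>), while \<open>\<delta>\<close>,
  \<open>\<delta>1\<close>, \<open>\<delta>2\<close> are the levels spent on the individual bounds.\<close>

definition lam :: "mean_form \<Rightarrow> tuning \<Rightarrow> real \<Rightarrow> (nat \<Rightarrow> real) \<Rightarrow> nat \<Rightarrow> real \<Rightarrow> nat \<Rightarrow> real" where
  "lam f c \<alpha> x n \<delta> t = min (sqrt (2 * ln (1 / \<delta>) / (m4sq_hat f c \<alpha> x t * real n))) (c1 c)"

definition wavg :: "(nat \<Rightarrow> real) \<Rightarrow> (nat \<Rightarrow> real) \<Rightarrow> nat \<Rightarrow> real" where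
  "wavg l y n = (\<Sum>i\<in>{1..n}. l i * y i) / (\<Sum>i\<in>{1..n}. l i)"

definition center :: "mean_form \<Rightarrow> tuning \<Rightarrow> real \<Rightarrow> (nat \<Rightarrow> real) \<Rightarrow> nat \<Rightarrow> real \<Rightarrow> real" where
  "center f c \<alpha> x n \<delta> = wavg (lam f c \<alpha> x n \<delta>) (\<lambda>i. (x i - mu_hat f c \<alpha> x i)\<^sup>2) n"

definition radius :: "mean_form \<Rightarrow> tuning \<Rightarrow> real \<Rightarrow> (nat \<Rightarrow> real) \<Rightarrow> nat \<Rightarrow> real \<Rightarrow> real" where
  "radius f c \<alpha> x n \<delta> =
     (ln (1 / \<delta>) + (\<Sum>i\<in>{1..n}. psiE (lam f c \<alpha> x n \<delta> i) *
                               ((x i - mu_hat f c \<alpha> x i)\<^sup>2 - sigma2_hat c x i)\<^sup>2))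
     / (\<Sum>i\<in>{1..n}. lam f c \<alpha> x n \<delta> i)"

definition upper_limit :: "mean_form \<Rightarrow> tuning \<Rightarrow> real \<Rightarrow> (nat \<Rightarrow> real) \<Rightarrow> nat \<Rightarrow> real" where
  "upper_limit f c \<alpha> x n = center f c \<alpha> x n \<alpha> + radius f c \<alpha> x n \<alpha>"

definition C2_tilde :: "tuning \<Rightarrow> real \<Rightarrow> (nat \<Rightarrow> real) \<Rightarrow> nat \<Rightarrow> real" where
  "C2_tilde c \<alpha> x t =
     (if t = 1 then 0
      else (\<Sum>i\<in>{1..<t}. psiP (lam_tilde c \<alpha> x i))\<^sup>2 / (\<Sum>i\<in>{1..<t}. lam_tilde c \<alpha> x i)\<^sup>2)"

definition C1_tilde :: "tuning \<Rightarrow> real \<Rightarrow> (nat \<Rightarrow> real) \<Rightarrow> real \<Rightarrow> nat \<Rightarrow> real" where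
  "C1_tilde c \<alpha> x \<delta> t =
     (if t = 1 then 0
      else 2 * ln (2 / \<delta>) * (\<Sum>i\<in>{1..<t}. psiP (lam_tilde c \<alpha> x i))
           / (\<Sum>i\<in>{1..<t}. lam_tilde c \<alpha> x i)\<^sup>2)"

definition C0_tilde :: "tuning \<Rightarrow> real \<Rightarrow> (nat \<Rightarrow> real) \<Rightarrow> real \<Rightarrow> nat \<Rightarrow> real" where
  "C0_tilde c \<alpha> x \<delta> t =
     (if t = 1 then 1 / 4 else (ln (2 / \<delta>))\<^sup>2 / (\<Sum>i\<in>{1..<t}. lam_tilde c \<alpha> x i)\<^sup>2)"

text \<open>The plug-ins and the center are those at level \<open>\<delta>2\<close>. The value is an extended real
  because it is \<open>-\<infinity>\<close> when the discriminant is negative.\<close>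

definition lower_limit ::
  "mean_form \<Rightarrow> tuning \<Rightarrow> real \<Rightarrow> (nat \<Rightarrow> real) \<Rightarrow> nat \<Rightarrow> real \<Rightarrow> real \<Rightarrow> ereal" where
  "lower_limit f c \<alpha> x n \<delta>1 \<delta>2 =
     (let l = lam f c \<alpha> x n \<delta>2;
          C2 = wavg l (C2_tilde c \<alpha> x) n;
          C1 = 1 + wavg l (C1_tilde c \<alpha> x \<delta>1) n;
          C0 = wavg l (C0_tilde c \<alpha> x \<delta>1) n;
          disc = C1\<^sup>2 + 4 * C2 * (center f c \<alpha> x n \<delta>2 - C0 - radius f c \<alpha> x n \<delta>2)
      in if disc < 0 then -\<infinity> else ereal ((- C1 + sqrt disc) / (2 * C2)))"

definition alpha1 :: "real \<Rightarrow> nat \<Rightarrow> real" where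
  "alpha1 \<alpha> n = 1 / ln (real n) * \<alpha>"

definition alpha2 :: "real \<Rightarrow> nat \<Rightarrow> real" where
  "alpha2 \<alpha> n = (ln (real n) - 1) / ln (real n) * \<alpha>"

end

theory Submission
  imports Defs
begin

text \<open>
  Let \<open>m\<^sub>i\<close> be the value of \<open>m4sq_hat\<close> at \<open>i\<close>. If \<open>m\<^sub>i \<rightarrow> v > 0\<close>, the plug-ins are
  \<open>\<lambda>\<^sub>i \<approx> sqrt (2 ln (1/\<delta>) / (v n))\<close>, and \<open>psiE \<lambda> \<approx> \<lambda>\<^sup>2 / 2\<close>. Both summands in the numerator of the
  radius then tend to \<open>ln (1/\<alpha>)\<close>, while \<open>\<Sum> \<lambda>\<^sub>i \<approx> sqrt (2 n ln (1/\<alpha>) / v)\<close>; the quotient times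
  \<open>sqrt n\<close> tends to \<open>sqrt (2 v ln (1/\<alpha>))\<close>, which is the claim for the upper limit. The lower limit
  \<open>L\<close> is a root of \<open>C\<^sub>2 L\<^sup>2 + C\<^sub>1 L = D - C\<^sub>0 - R\<close>, so that
  \<open>D - L = C\<^sub>0 + R + (C\<^sub>1 - 1) L + C\<^sub>2 L\<^sup>2\<close>. The radius \<open>R\<close> gives the same limit as before, because
  \<open>\<alpha>\<^sub>2 \<rightarrow> \<alpha>\<close>, and the three corrections are \<open>o(1 / sqrt n)\<close>: the sums of the \<open>\<lambda>\<close>-tilde up to \<open>t\<close>
  grow like \<open>sqrt t\<close> up to logarithms if \<open>\<sigma>\<^sup>2 > 0\<close>, so each correction is a \<open>\<lambda>\<close>-weighted average of
  terms of size \<open>1 / i\<close> up to logarithms.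

  The degenerate case \<open>v = 0\<close> (for instance a fair coin) breaks this argument, as the weights
  \<open>sqrt n \<lambda>\<^sub>i\<close> are then unbounded. Consistency \<open>m\<^sub>i \<rightarrow> 0\<close> alone does not control a \<open>\<lambda>\<close>-weighted average of
  \<open>1 / i\<close> well enough, since large weights may sit on small indices; a polynomial rate for \<open>m\<^sub>i \<rightarrow> 0\<close>
  does. This is why the whole development tracks polynomial rates (\<open>poly_null\<close>) in place of mere
  convergence. If moreover \<open>\<sigma>\<^sup>2 = 0\<close>, then all observations equal \<open>\<mu>\<close>, \<open>C\<^sub>2\<close> decays too slowly, and
  one uses instead that the center itself is \<open>o(1 / sqrt n)\<close>.

  Apart from the constancy of the observations for \<open>\<sigma>\<^sup>2 = 0\<close>, the probabilistic input is confined to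
  \<open>const_cond_mean_average_poly_null\<close>: averages of \<open>X\<^sub>i - \<mu>\<close>,
  \<open>(X\<^sub>i - \<mu>)\<^sup>2 - \<sigma>\<^sup>2\<close> and \<open>((X\<^sub>i - \<mu>)\<^sup>2 - \<sigma>\<^sup>2)\<^sup>2 - v\<close> are bounded martingale difference averages, hence
  almost surely of polynomial decay. Everything else is a deterministic statement about one path on
  which these three rates hold (locale \<open>regular_path\<close>): the rates pass to the estimators, the locale
  \<open>plug_in_weights\<close> turns a rate for \<open>m\<^sub>i\<close> into \<open>rad_tendsto\<close> and \<open>sqrt_wavg_tendsto_0\<close>, and
  \<open>upper_limit_tendsto\<close> and \<open>lower_limit_tendsto\<close> combine these.
\<close>

section \<open>Sequences of polynomial decay\<close>

definition poly_null :: "(nat \<Rightarrow> real) \<Rightarrow> bool" where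
  "poly_null y \<longleftrightarrow> (\<exists>e>0. \<exists>K. \<forall>n\<ge>1. \<bar>y n\<bar> \<le> K * real n powr - e)"

lemma poly_nullI:
  assumes "e > 0" "\<And>n. n \<ge> 1 \<Longrightarrow> \<bar>y n\<bar> \<le> K * real n powr - e"
  shows "poly_null y"
  using assms unfolding poly_null_def by blast

lemma poly_nullI_eventually:
  assumes "e > 0" and ev: "eventually (\<lambda>n. \<bar>y n\<bar> \<le> K * real n powr - e) sequentially"
  shows "poly_null y"
proof -
  obtain N where N: "\<And>n. n \<ge> N \<Longrightarrow> \<bar>y n\<bar> \<le> K * real n powr - e"
    using ev unfolding eventually_sequentially by blast
  define K' where "K' = \<bar>K\<bar> + (\<Sum>i\<in>{1..N}. \<bar>y i\<bar> * real i powr e)"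
  have s0: "(\<Sum>i\<in>{1..N}. \<bar>y i\<bar> * real i powr e) \<ge> 0" by (intro sum_nonneg) auto
  show ?thesis
  proof (rule poly_nullI[OF \<open>e > 0\<close>])
    fix n :: nat assume n: "n \<ge> 1"
    show "\<bar>y n\<bar> \<le> K' * real n powr - e"
    proof (cases "n \<ge> N")
      case True
      have "K * real n powr - e \<le> K' * real n powr - e"
        unfolding K'_def using s0 by (intro mult_right_mono) auto
      then show ?thesis using N[OF True] by linarith
    next
      case False
      have "\<bar>y n\<bar> * real n powr e \<le> (\<Sum>i\<in>{1..N}. \<bar>y i\<bar> * real i powr e)"
        by (rule member_le_sum) (use n False in auto)
      also have "\<dots> \<le> K'" unfolding K'_def by simp
      finally have "\<bar>y n\<bar> * real n powr e * real n powr - e \<le> K' * real n powr - e"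
        by (rule mult_right_mono) simp
      then show ?thesis using n by (simp add: mult.assoc flip: powr_add)
    qed
  qed
qed

text \<open>The exponent may be taken as small as one likes; sums of \<open>i powr - e\<close> are only well behaved for
  \<open>e < 1\<close>.\<close>
lemma poly_nullE:
  assumes "poly_null y" "a > 0"
  obtains e K where "0 < e" "e \<le> a" "K > 0" "\<And>n. n \<ge> 1 \<Longrightarrow> \<bar>y n\<bar> \<le> K * real n powr - e"
proof -
  obtain e K where e: "e > 0" and K: "\<And>n. n \<ge> 1 \<Longrightarrow> \<bar>y n\<bar> \<le> K * real n powr - e"
    using assms unfolding poly_null_def by blast
  have "\<bar>y n\<bar> \<le> (\<bar>K\<bar> + 1) * real n powr - min e a" if n: "n \<ge> 1" for n
  proof -
    have "\<bar>y n\<bar> \<le> K * real n powr - e" by (rule K[OF n])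
    also have "\<dots> \<le> (\<bar>K\<bar> + 1) * real n powr - min e a"
      using n by (intro mult_mono powr_mono) auto
    finally show ?thesis .
  qed
  then show ?thesis using that[of "min e a" "\<bar>K\<bar> + 1"] e assms(2) by auto
qed

lemma poly_null_bounded:
  assumes "poly_null y"
  obtains K where "K > 0" "\<And>n. n \<ge> 1 \<Longrightarrow> \<bar>y n\<bar> \<le> K"
proof -
  obtain e K where e: "0 < e" "e \<le> 1" "K > 0"
    and K: "\<And>n. n \<ge> 1 \<Longrightarrow> \<bar>y n\<bar> \<le> K * real n powr - e"
    by (rule poly_nullE[OF assms zero_less_one]) (rule that)
  have "\<bar>y n\<bar> \<le> K" if "n \<ge> 1" for n
  proof -
    have "real n powr - e \<le> real n powr 0" using that e by (intro powr_mono) auto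
    then have "K * real n powr - e \<le> K * 1" using that e by (intro mult_left_mono) auto
    then show ?thesis using K[OF that] by simp
  qed
  then show ?thesis using that e by blast
qed

lemma poly_null_cong:
  assumes "poly_null y" "\<And>n. n \<ge> 1 \<Longrightarrow> y n = z n"
  shows "poly_null z"
  using assms unfolding poly_null_def by auto

lemma poly_null_add:
  assumes "poly_null y" "poly_null z"
  shows "poly_null (\<lambda>n. y n + z n)"
proof -
  obtain e K where e: "0 < e" "e \<le> 1" "K > 0"
    and K: "\<And>n. n \<ge> 1 \<Longrightarrow> \<bar>y n\<bar> \<le> K * real n powr - e"
    by (rule poly_nullE[OF assms(1) zero_less_one]) (rule that)
  obtain e' K' where e': "0 < e'" "e' \<le> e" "K' > 0"
    and K': "\<And>n. n \<ge> 1 \<Longrightarrow> \<bar>z n\<bar> \<le> K' * real n powr - e'"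
    by (rule poly_nullE[OF assms(2) e(1)]) (rule that)
  show ?thesis
  proof (rule poly_nullI[OF e'(1)])
    fix n :: nat assume n: "n \<ge> 1"
    have "K * real n powr - e \<le> K * real n powr - e'"
      using n e e' by (intro mult_left_mono powr_mono) auto
    then show "\<bar>y n + z n\<bar> \<le> (K + K') * real n powr - e'"
      using K[OF n] K'[OF n] by (simp add: algebra_simps)
  qed
qed

lemma poly_null_mult_bounded:
  assumes "poly_null y" "\<And>n. n \<ge> 1 \<Longrightarrow> \<bar>b n\<bar> \<le> B"
  shows "poly_null (\<lambda>n. b n * y n)"
proof -
  obtain e K where e: "0 < e" "e \<le> 1" "K > 0"
    and K: "\<And>n. n \<ge> 1 \<Longrightarrow> \<bar>y n\<bar> \<le> K * real n powr - e"
    by (rule poly_nullE[OF assms(1) zero_less_one]) (rule that)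
  show ?thesis
  proof (rule poly_nullI[OF e(1)])
    fix n :: nat assume n: "n \<ge> 1"
    have "\<bar>b n\<bar> * \<bar>y n\<bar> \<le> B * (K * real n powr - e)"
      using assms(2)[OF n] K[OF n] by (intro mult_mono) auto
    then show "\<bar>b n * y n\<bar> \<le> (B * K) * real n powr - e" by (simp add: abs_mult mult.assoc)
  qed
qed

lemma poly_null_cmult: "poly_null y \<Longrightarrow> poly_null (\<lambda>n. a * y n)"
  by (rule poly_null_mult_bounded[where B = "\<bar>a\<bar>"]) auto

lemma poly_null_diff: "poly_null y \<Longrightarrow> poly_null z \<Longrightarrow> poly_null (\<lambda>n. y n - z n)"
  using poly_null_add[of y "\<lambda>n. - 1 * z n"] poly_null_cmult[of z "-1"] by simp

lemma poly_null_inverse_nat: "poly_null (\<lambda>n. a / real n)"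
proof (rule poly_nullI[of 1 _ "\<bar>a\<bar>"])
  fix n :: nat assume "n \<ge> 1"
  then show "\<bar>a / real n\<bar> \<le> \<bar>a\<bar> * real n powr - 1" by (simp add: powr_minus divide_simps)
qed simp

lemma poly_null_tendsto:
  assumes "poly_null (\<lambda>n. y n - l)"
  shows "y \<longlonglongrightarrow> l"
proof -
  obtain e K where e: "0 < e" "e \<le> 1" "K > 0"
    and K: "\<And>n. n \<ge> 1 \<Longrightarrow> \<bar>y n - l\<bar> \<le> K * real n powr - e"
    by (rule poly_nullE[OF assms(1) zero_less_one]) (rule that)
  have "(\<lambda>n. K * real n powr - e) \<longlonglongrightarrow> K * 0"
    using e by (intro tendsto_mult tendsto_const tendsto_neg_powr filterlim_real_sequentially) auto
  then have lim: "(\<lambda>n. K * real n powr - e) \<longlonglongrightarrow> 0" by simp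
  have "\<forall>\<^sub>F n in sequentially. norm (y n - l) \<le> K * real n powr - e"
    by (rule eventually_sequentiallyI[of 1]) (use K in simp)
  from Lim_null_comparison[OF this lim] show ?thesis by (rule LIM_zero_cancel)
qed

lemma sum_powr_neg_le:
  assumes "0 \<le> e" "e < 1"
  shows "(\<Sum>i\<in>{1..n}. real i powr - e) \<le> real n powr (1 - e) / (1 - e)"
proof (induction n)
  case 0 then show ?case by simp
next
  case (Suc n)
  have step: "real (Suc n) powr - e * (1 - e) \<le> real (Suc n) powr (1 - e) - real n powr (1 - e)"
  proof (cases "n = 0")
    case True then show ?thesis using assms by simp
  next
    case False
    have "\<exists>z. real n < z \<and> z < real (Suc n) \<and>
        real (Suc n) powr (1 - e) - real n powr (1 - e)
          = (real (Suc n) - real n) * ((1 - e) * z powr ((1 - e) - 1))"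
      by (rule MVT2) (use False in \<open>auto intro!: derivative_eq_intros simp: field_simps\<close>)
    then obtain z where z: "real n < z" "z < real (Suc n)"
      "real (Suc n) powr (1 - e) - real n powr (1 - e) = (1 - e) * z powr - e" by auto
    have "real (Suc n) powr - e \<le> z powr - e"
      using z False assms by (intro powr_mono2') auto
    then show ?thesis unfolding z(3) using assms by (simp add: mult.commute mult_left_mono)
  qed
  have "(\<Sum>i\<in>{1..Suc n}. real i powr - e) \<le> real n powr (1 - e) / (1 - e) + real (Suc n) powr - e"
    using Suc by simp
  also have "\<dots> \<le> real (Suc n) powr (1 - e) / (1 - e)"
  proof -
    have "real (Suc n) powr - e \<le> (real (Suc n) powr (1 - e) - real n powr (1 - e)) / (1 - e)"
      using step assms by (subst pos_le_divide_eq) auto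
    then show ?thesis unfolding diff_divide_distrib by linarith
  qed
  finally show ?case .
qed

lemma sum_lessThan_powr_neg_le:
  assumes "0 \<le> e" "e < 1"
  shows "(\<Sum>i\<in>{1..<n}. real i powr - e) \<le> real n powr (1 - e) / (1 - e)"
proof -
  have "(\<Sum>i\<in>{1..<n}. real i powr - e) \<le> (\<Sum>i\<in>{1..n}. real i powr - e)"
    by (intro sum_mono2) auto
  then show ?thesis using sum_powr_neg_le[OF assms, of n] by linarith
qed

lemma poly_null_mean:
  assumes "poly_null y"
  shows "poly_null (\<lambda>n. (\<Sum>i\<in>{1..<n}. y i) / real n)"
proof -
  have half: "(0::real) < 1 / 2" by simp
  obtain e K where e: "0 < e" "e \<le> 1/2" "K > 0"
    and K: "\<And>n. n \<ge> 1 \<Longrightarrow> \<bar>y n\<bar> \<le> K * real n powr - e"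
    by (rule poly_nullE[OF assms half]) (rule that)
  show ?thesis
  proof (rule poly_nullI[OF e(1)])
    fix n :: nat assume n: "n \<ge> 1"
    have "\<bar>\<Sum>i\<in>{1..<n}. y i\<bar> \<le> (\<Sum>i\<in>{1..<n}. \<bar>y i\<bar>)" by (rule sum_abs)
    also have "\<dots> \<le> (\<Sum>i\<in>{1..<n}. K * real i powr - e)" by (intro sum_mono K) auto
    also have "\<dots> = K * (\<Sum>i\<in>{1..<n}. real i powr - e)" by (simp add: sum_distrib_left)
    also have "\<dots> \<le> K * (real n powr (1 - e) / (1 - e))"
      using e by (intro mult_left_mono sum_lessThan_powr_neg_le) auto
    also have "\<dots> = (K / (1 - e)) * real n powr - e * real n"
      using n by (simp add: powr_diff powr_minus divide_simps)
    finally have "\<bar>\<Sum>i\<in>{1..<n}. y i\<bar> \<le> (K / (1 - e)) * real n powr - e * real n" .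
    then show "\<bar>(\<Sum>i\<in>{1..<n}. y i) / real n\<bar> \<le> (K / (1 - e)) * real n powr - e"
      using n by (simp add: abs_divide pos_divide_le_eq)
  qed
qed

text \<open>The shape of \<open>mu_bar\<close>, \<open>sigma2_hat\<close> and \<open>m4sq_hat\<close>: an average over the past with an
  initial value \<open>a\<close>, of terms \<open>z i\<close> in which running estimates replace the true parameters of \<open>y i\<close>.\<close>
lemma poly_null_mean_perturb:
  assumes "poly_null (\<lambda>n. (\<Sum>i\<in>{1..<n}. y i - l) / real n)" "poly_null (\<lambda>i. z i - y i)"
  shows "poly_null (\<lambda>n. (a + (\<Sum>i\<in>{1..<n}. z i)) / real n - l)"
proof -
  have "poly_null (\<lambda>n. (\<Sum>i\<in>{1..<n}. y i - l) / real n + (\<Sum>i\<in>{1..<n}. z i - y i) / real n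
      + (a - l) / real n)"
    by (intro poly_null_add assms poly_null_mean poly_null_inverse_nat)
  then show ?thesis
    by (rule poly_null_cong)
       (auto simp: sum_subtractf of_nat_diff field_simps)
qed

lemma average_tendsto:
  assumes "poly_null (\<lambda>n. u n - l)"
  shows "(\<lambda>n. (\<Sum>i\<in>{1..n}. u i) / real n) \<longlonglongrightarrow> l"
proof -
  obtain B where B: "B > 0" "\<And>n. n \<ge> 1 \<Longrightarrow> \<bar>u n - l\<bar> \<le> B"
    by (rule poly_null_bounded[OF assms]) (rule that)
  have "poly_null (\<lambda>n. (u n - l) * (1 / real n))"
    by (rule poly_null_mult_bounded[OF poly_null_inverse_nat B(2)])
  with poly_null_mean[OF assms]
  have "poly_null (\<lambda>n. (\<Sum>i\<in>{1..<n}. u i - l) / real n + (u n - l) * (1 / real n))"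
    by (rule poly_null_add)
  then have "poly_null (\<lambda>n. (\<Sum>i\<in>{1..n}. u i) / real n - l)"
  proof (rule poly_null_cong)
    fix n :: nat assume n: "n \<ge> 1"
    have "{1..n} = insert n {1..<n}" using n by auto
    then have "(\<Sum>i\<in>{1..n}. u i - l) = (u n - l) + (\<Sum>i\<in>{1..<n}. u i - l)" by simp
    moreover have "(\<Sum>i\<in>{1..n}. u i - l) = (\<Sum>i\<in>{1..n}. u i) - real n * l"
      by (simp add: sum_subtractf)
    ultimately have *: "(\<Sum>i\<in>{1..<n}. u i - l) = (\<Sum>i\<in>{1..n}. u i) - real n * l - (u n - l)"
      by linarith
    show "(\<Sum>i\<in>{1..<n}. u i - l) / real n + (u n - l) * (1 / real n)
        = (\<Sum>i\<in>{1..n}. u i) / real n - l"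
      unfolding * using n by (simp add: diff_divide_distrib)
  qed
  then show ?thesis by (rule poly_null_tendsto)
qed

lemma tendsto_zero_powr_bound:
  assumes "e > 0" "eventually (\<lambda>n. \<bar>y n\<bar> \<le> K * real n powr - e) sequentially"
  shows "y \<longlonglongrightarrow> 0"
proof -
  have "poly_null (\<lambda>n. y n - 0)" using poly_nullI_eventually[OF assms] by simp
  then show ?thesis by (rule poly_null_tendsto)
qed

lemma poly_null_power2_diff:
  assumes "poly_null (\<lambda>i. u i - w i)" "\<And>i. i \<ge> 1 \<Longrightarrow> \<bar>w i\<bar> \<le> B"
  shows "poly_null (\<lambda>i. (u i)\<^sup>2 - (w i)\<^sup>2)"
proof -
  obtain K where K: "\<And>i. i \<ge> 1 \<Longrightarrow> \<bar>u i - w i\<bar> \<le> K"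
    by (rule poly_null_bounded[OF assms(1)]) (rule that)
  have "\<bar>u i + w i\<bar> \<le> K + 2 * B" if "i \<ge> 1" for i
    using K[OF that] assms(2)[OF that] by linarith
  then have "poly_null (\<lambda>i. (u i + w i) * (u i - w i))"
    by (rule poly_null_mult_bounded[OF assms(1)])
  then show ?thesis by (simp only: power2_eq_square square_diff_square_factored)
qed

lemma poly_null_zero: "poly_null (\<lambda>_. 0)"
  by (rule poly_nullI[of 1 _ 0]) auto

lemma pos_seq_bounded_below:
  fixes y :: "nat \<Rightarrow> real"
  assumes "y \<longlonglongrightarrow> l" "l > 0" "\<And>n. n \<ge> 1 \<Longrightarrow> y n > 0"
  obtains k where "k > 0" "\<And>n. n \<ge> 1 \<Longrightarrow> k \<le> y n"
proof -
  have "(\<lambda>n. inverse (y n)) \<longlonglongrightarrow> inverse l" using assms by (intro tendsto_inverse) auto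
  then have "Bseq (\<lambda>n. inverse (y n))" by (simp add: convergentI convergent_imp_Bseq)
  then obtain K where K: "K > 0" "\<And>n. \<bar>inverse (y n)\<bar> \<le> K" unfolding Bseq_def by auto
  have "inverse K \<le> y n" if "n \<ge> 1" for n
    using K(2)[of n] assms(3)[OF that] K(1) by (simp add: field_simps)
  then show ?thesis using that[of "inverse K"] K by auto
qed

section \<open>Summation against monotone weights\<close>

text \<open>Summation by parts: with \<open>U\<^sub>k\<close> the partial sums of \<open>u\<close>, induction keeps
  \<open>\<Sum> w\<^sub>i u\<^sub>i \<ge> w\<^sub>k U\<^sub>k\<close>.\<close>
lemma sum_mult_antimono_nonneg:
  fixes w u :: "nat \<Rightarrow> real"
  assumes U: "\<And>k. 1 \<le> k \<Longrightarrow> k \<le> n \<Longrightarrow> 0 \<le> (\<Sum>i\<in>{1..k}. u i)"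
    and w: "\<And>i. 1 \<le> i \<Longrightarrow> i < n \<Longrightarrow> w (Suc i) \<le> w i" and w0: "n \<ge> 1 \<Longrightarrow> 0 \<le> w n"
  shows "0 \<le> (\<Sum>i\<in>{1..n}. w i * u i)"
proof (cases "n = 0")
  case False
  have "w k * (\<Sum>i\<in>{1..k}. u i) \<le> (\<Sum>i\<in>{1..k}. w i * u i)" if "1 \<le> k" "k \<le> n" for k
    using that
  proof (induction k rule: nat_induct_at_least)
    case base then show ?case by simp
  next
    case (Suc k)
    have "w (Suc k) * (\<Sum>i\<in>{1..k}. u i) \<le> w k * (\<Sum>i\<in>{1..k}. u i)"
      using Suc by (intro mult_right_mono w U) auto
    then show ?case using Suc by (simp add: algebra_simps)
  qed
  from this[of n] have "w n * (\<Sum>i\<in>{1..n}. u i) \<le> (\<Sum>i\<in>{1..n}. w i * u i)"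
    using False by simp
  moreover have "0 \<le> w n * (\<Sum>i\<in>{1..n}. u i)"
    using False by (intro mult_nonneg_nonneg w0 U) auto
  ultimately show ?thesis by linarith
qed simp

lemma abs_sum_mult_antimono_le:
  fixes w y z :: "nat \<Rightarrow> real"
  assumes U: "\<And>k. 1 \<le> k \<Longrightarrow> k \<le> n \<Longrightarrow> \<bar>\<Sum>i\<in>{1..k}. y i\<bar> \<le> (\<Sum>i\<in>{1..k}. z i)"
    and w: "\<And>i. 1 \<le> i \<Longrightarrow> i < n \<Longrightarrow> w (Suc i) \<le> w i" and w0: "n \<ge> 1 \<Longrightarrow> 0 \<le> w n"
  shows "\<bar>\<Sum>i\<in>{1..n}. w i * y i\<bar> \<le> (\<Sum>i\<in>{1..n}. w i * z i)"
proof -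
  have 1: "0 \<le> (\<Sum>i\<in>{1..n}. w i * (z i - y i))"
    by (rule sum_mult_antimono_nonneg) (use U w w0 in \<open>force simp: sum_subtractf\<close>)+
  have 2: "0 \<le> (\<Sum>i\<in>{1..n}. w i * (z i + y i))"
    by (rule sum_mult_antimono_nonneg) (use U w w0 in \<open>force simp: sum.distrib\<close>)+
  from 1 2 show ?thesis by (simp add: algebra_simps sum_subtractf sum.distrib abs_le_iff)
qed

lemma wavg_bounds:
  assumes pos: "\<forall>i\<in>{1..n}. 0 < l i" and n: "n \<ge> 1"
    and y: "\<And>i. i \<in> {1..n} \<Longrightarrow> 0 \<le> y i" "\<And>i. i \<in> {1..n} \<Longrightarrow> y i \<le> B"
  shows "0 \<le> wavg l y n" "wavg l y n \<le> B"
proof -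
  have H: "0 < (\<Sum>i\<in>{1..n}. l i)" using pos n by (intro sum_pos) auto
  have "0 \<le> (\<Sum>i\<in>{1..n}. l i * y i)"
    using pos y by (intro sum_nonneg mult_nonneg_nonneg) (auto intro: less_imp_le)
  then show "0 \<le> wavg l y n" using H by (simp add: wavg_def)
  have "(\<Sum>i\<in>{1..n}. l i * y i) \<le> (\<Sum>i\<in>{1..n}. l i * B)"
    using pos y by (intro sum_mono mult_left_mono) (auto intro: less_imp_le)
  also have "\<dots> = B * (\<Sum>i\<in>{1..n}. l i)" by (simp add: sum_distrib_left mult.commute)
  finally show "wavg l y n \<le> B" using H by (simp add: wavg_def pos_divide_le_eq)
qed

section \<open>The functions psiE and psiP\<close>

lemma psiP_le: "0 \<le> l \<Longrightarrow> psiP l \<le> exp l * l\<^sup>2"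
proof -
  assume l: "0 \<le> l"
  have "1 - l \<le> exp (- l)" using exp_ge_add_one_self[of "-l"] by simp
  then have "exp l * (1 - l) \<le> exp l * exp (- l)" by (intro mult_left_mono) auto
  then have a: "exp l - 1 \<le> l * exp l" by (simp add: algebra_simps flip: exp_add)
  have "l * (exp l - 1) \<le> l * (l * exp l)" by (rule mult_left_mono[OF a l])
  then show ?thesis using a unfolding psiP_def by (simp add: algebra_simps power2_eq_square)
qed

lemma psiP_pos: "0 < l \<Longrightarrow> 0 < psiP l"
  unfolding psiP_def using exp_minus_greater[of "-l"] by simp

lemma psiE_has_derivative:
  assumes "x < 1"
  shows "(psiE has_real_derivative x / (1 - x)) (at x)"
proof -
  have "((\<lambda>l. - ln (1 - l) - l) has_real_derivative x / (1 - x)) (at x)"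
    using assms by (auto intro!: derivative_eq_intros simp: field_simps)
  then show ?thesis unfolding psiE_def[abs_def] .
qed

text \<open>After subtracting \<open>l\<^sup>2 / 2\<close>, the derivative of \<open>psiE\<close> is \<open>l\<^sup>2 / (1 - l)\<close>, which is nonnegative
  and at most \<open>l\<^sup>2 / (1 - c)\<close>.\<close>
lemma psiE_bounds:
  assumes "0 \<le> l" "l \<le> c" "c < 1"
  shows "l\<^sup>2 / 2 \<le> psiE l" "psiE l \<le> l\<^sup>2 / 2 + l ^ 3 / (1 - c)"
proof -
  have *: "x / (1 - x) = x + x\<^sup>2 / (1 - x)" if "0 \<le> x" "x \<le> l" for x
    using that assms by (simp add: field_simps power2_eq_square)
  have "psiE 0 - 0\<^sup>2 / 2 \<le> psiE l - l\<^sup>2 / 2"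
  proof (rule DERIV_nonneg_imp_nondecreasing[OF assms(1)])
    fix x assume x: "0 \<le> x" "x \<le> l"
    have "((\<lambda>x. psiE x - x\<^sup>2 / 2) has_real_derivative x / (1 - x) - x) (at x)"
      using x assms by (auto intro!: derivative_eq_intros psiE_has_derivative)
    moreover have "x / (1 - x) - x \<ge> 0" using x assms by (simp add: *)
    ultimately show "\<exists>y. ((\<lambda>x. psiE x - x\<^sup>2 / 2) has_real_derivative y) (at x) \<and> 0 \<le> y" by blast
  qed
  then show "l\<^sup>2 / 2 \<le> psiE l" by (simp add: psiE_def)
  have "0\<^sup>2 / 2 + 0 ^ 3 / (1 - c) - psiE 0 \<le> l\<^sup>2 / 2 + l ^ 3 / (1 - c) - psiE l"
  proof (rule DERIV_nonneg_imp_nondecreasing[OF assms(1)])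
    fix x assume x: "0 \<le> x" "x \<le> l"
    have "((\<lambda>x. x\<^sup>2 / 2 + x ^ 3 / (1 - c) - psiE x) has_real_derivative
        x + 3 * x\<^sup>2 / (1 - c) - x / (1 - x)) (at x)"
      using x assms by (auto intro!: derivative_eq_intros psiE_has_derivative)
    moreover have "x + 3 * x\<^sup>2 / (1 - c) - x / (1 - x) \<ge> 0"
    proof -
      have "x\<^sup>2 / (1 - x) \<le> x\<^sup>2 / (1 - c)" using x assms by (intro divide_left_mono) auto
      moreover have "0 \<le> x\<^sup>2 / (1 - c)" using assms by auto
      ultimately show ?thesis unfolding *[OF x] by (simp add: field_simps)
    qed
    ultimately show "\<exists>y. ((\<lambda>x. x\<^sup>2 / 2 + x ^ 3 / (1 - c) - psiE x) has_real_derivative y) (at x) \<and> 0 \<le> y"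
      by blast
  qed
  then show "psiE l \<le> l\<^sup>2 / 2 + l ^ 3 / (1 - c)" by (simp add: psiE_def)
qed

section \<open>A strong law of large numbers with a rate\<close>

text \<open>By orthogonality the partial sums \<open>T\<^sub>n\<close> have second moment at most \<open>n B\<^sup>2\<close>. Chebyshev's inequality
  and Borel-Cantelli along the squares give \<open>\<bar>T\<bar> \<le> n powr (7/8)\<close> eventually for \<open>n = k\<^sup>2\<close>, and between
  consecutive squares \<open>T\<close> moves by at most \<open>2 k B\<close>.\<close>
lemma (in prob_space) orthogonal_bounded_average_poly_null:
  fixes Y :: "nat \<Rightarrow> 'a \<Rightarrow> real"
  assumes Ym: "\<And>i. i \<ge> 1 \<Longrightarrow> Y i \<in> borel_measurable M"
    and bd: "\<And>i. i \<ge> 1 \<Longrightarrow> AE w in M. \<bar>Y i w\<bar> \<le> B"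
    and orth: "\<And>i j. 1 \<le> i \<Longrightarrow> i < j \<Longrightarrow> expectation (\<lambda>w. Y i w * Y j w) = 0"
  shows "AE w in M. poly_null (\<lambda>n. (\<Sum>i\<in>{1..<n}. Y i w) / real n)"
proof -
  define T where "T n w = (\<Sum>i\<in>{1..<n}. Y i w)" for n w
  have Tm [measurable]: "T n \<in> borel_measurable M" for n
    unfolding T_def using Ym by (intro borel_measurable_sum) auto
  have prod_bd: "AE w in M. \<bar>Y i w * Y j w\<bar> \<le> B\<^sup>2" if "i \<ge> 1" "j \<ge> 1" for i j
    using bd[OF that(1)] bd[OF that(2)]
    by eventually_elim (auto simp: abs_mult power2_eq_square intro!: mult_mono)
  have int: "integrable M (\<lambda>w. Y i w * Y j w)" if "i \<ge> 1" "j \<ge> 1" for i j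
    using prod_bd[OF that] Ym that
    by (intro integrable_const_bound[where B = "B\<^sup>2"]) auto
  have T2: "(T n w)\<^sup>2 = (\<Sum>i\<in>{1..<n}. \<Sum>j\<in>{1..<n}. Y i w * Y j w)" for n w
    unfolding T_def by (simp add: power2_eq_square sum_product)
  have intT: "integrable M (\<lambda>w. (T n w)\<^sup>2)" for n
    unfolding T2 by (intro Bochner_Integration.integrable_sum int) auto
  have second_moment: "expectation (\<lambda>w. (T n w)\<^sup>2) \<le> real n * B\<^sup>2" for n
  proof -
    have off: "expectation (\<lambda>w. Y i w * Y j w) = 0" if "1 \<le> i" "1 \<le> j" "j \<noteq> i" for i j
    proof (cases "i < j")
      case True then show ?thesis using orth that by blast
    next
      case False
      then have "expectation (\<lambda>w. Y j w * Y i w) = 0" using orth[of j i] that by simp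
      then show ?thesis by (simp add: mult.commute)
    qed
    have diag: "expectation (\<lambda>w. Y i w * Y i w) \<le> B\<^sup>2" if "1 \<le> i" for i
    proof -
      have "expectation (\<lambda>w. Y i w * Y i w) \<le> expectation (\<lambda>w. B\<^sup>2)"
      proof (rule integral_mono_AE[OF int[OF that that]])
        show "AE w in M. Y i w * Y i w \<le> B\<^sup>2" using prod_bd[OF that that] by eventually_elim simp
      qed simp
      then show ?thesis by (simp add: prob_space)
    qed
    have "expectation (\<lambda>w. (T n w)\<^sup>2)
        = (\<Sum>i\<in>{1..<n}. \<Sum>j\<in>{1..<n}. expectation (\<lambda>w. Y i w * Y j w))"
      unfolding T2 by (subst Bochner_Integration.integral_sum;
          (intro sum.cong refl Bochner_Integration.integral_sum Bochner_Integration.integrable_sum)?)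
        (auto intro: int)
    also have "\<dots> = (\<Sum>i\<in>{1..<n}. expectation (\<lambda>w. Y i w * Y i w))"
    proof (rule sum.cong[OF refl])
      fix i assume i: "i \<in> {1..<n}"
      have "(\<Sum>j\<in>{1..<n}. expectation (\<lambda>w. Y i w * Y j w))
          = expectation (\<lambda>w. Y i w * Y i w) + (\<Sum>j\<in>{1..<n} - {i}. expectation (\<lambda>w. Y i w * Y j w))"
        using i by (intro sum.remove) auto
      also have "(\<Sum>j\<in>{1..<n} - {i}. expectation (\<lambda>w. Y i w * Y j w)) = 0"
        using i by (intro sum.neutral ballI off) auto
      finally show "(\<Sum>j\<in>{1..<n}. expectation (\<lambda>w. Y i w * Y j w))
          = expectation (\<lambda>w. Y i w * Y i w)" by simp
    qed
    also have "\<dots> \<le> (\<Sum>i\<in>{1..<n}. B\<^sup>2)" by (intro sum_mono diag) auto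
    also have "\<dots> \<le> real n * B\<^sup>2" by (simp add: mult_right_mono)
    finally show ?thesis .
  qed
  \<comment> \<open>Any exponent above \<open>3/2\<close> makes the probabilities summable in \<open>k\<close>, and any exponent below \<open>2\<close>
    leaves a polynomial rate.\<close>
  define A where "A k = {w \<in> space M. real (k\<^sup>2) powr (7/4) \<le> (T (k\<^sup>2) w)\<^sup>2}" for k :: nat
  have Am [measurable]: "A k \<in> sets M" for k unfolding A_def by measurable
  have PA: "measure M (A k) \<le> B\<^sup>2 * real k powr - (3/2)" if k: "k \<ge> 1" for k
  proof -
    have "measure M (A k) \<le> expectation (\<lambda>w. (T (k\<^sup>2) w)\<^sup>2) / real (k\<^sup>2) powr (7/4)"
      unfolding A_def using k
      by (intro integral_Markov_inequality_measure[OF intT sets.empty_sets]) auto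
    also have "\<dots> \<le> real (k\<^sup>2) * B\<^sup>2 / real (k\<^sup>2) powr (7/4)"
      by (intro divide_right_mono second_moment) auto
    also have "\<dots> = B\<^sup>2 * (real (k\<^sup>2) powr 1 / real (k\<^sup>2) powr (7/4))" using k by simp
    also have "real (k\<^sup>2) powr 1 / real (k\<^sup>2) powr (7/4) = real (k\<^sup>2) powr - (3/4)"
    proof -
      have "- (3/4) = 1 - (7/4 :: real)" by simp
      then show ?thesis by (simp only: powr_diff)
    qed
    also have "real (k\<^sup>2) powr - (3/4) = real k powr - (3/2)"
    proof -
      have sq: "real (k\<^sup>2) = real k powr 2" using k by simp
      show ?thesis unfolding sq powr_powr by simp
    qed
    finally show ?thesis .
  qed
  have "summable (\<lambda>k. measure M (A k))"
  proof (rule summable_comparison_test')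
    show "summable (\<lambda>k. B\<^sup>2 * real k powr - (3/2))"
      by (intro summable_mult) (simp add: summable_real_powr_iff)
    show "\<And>k. k \<ge> 1 \<Longrightarrow> norm (measure M (A k)) \<le> B\<^sup>2 * real k powr - (3/2)"
      using PA by simp
  qed
  then have ev: "AE w in M. eventually (\<lambda>k. w \<in> space M - A k) sequentially"
    by (intro borel_cantelli_AE1) (auto simp: emeasure_eq_measure)
  have allbd: "AE w in M. \<forall>i\<in>{1..}. \<bar>Y i w\<bar> \<le> B"
    by (intro AE_ball_countable') (use bd in auto)
  from ev allbd show ?thesis
  proof eventually_elim
    fix w assume ev: "eventually (\<lambda>k. w \<in> space M - A k) sequentially"
      and bd: "\<forall>i\<in>{1..}. \<bar>Y i w\<bar> \<le> B"
    have B0: "B \<ge> 0" using bd[rule_format, of 1] by simp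
    obtain k0 where k0: "\<And>k. k \<ge> k0 \<Longrightarrow> w \<in> space M - A k"
      using ev unfolding eventually_sequentially by blast
    have Tk: "\<bar>T (k\<^sup>2) w\<bar> \<le> real (k\<^sup>2) powr (7/8)" if "k \<ge> k0" for k
    proof -
      have "(T (k\<^sup>2) w)\<^sup>2 \<le> real (k\<^sup>2) powr (7/4)" using k0[OF that] by (auto simp: A_def)
      also have "\<dots> = (real (k\<^sup>2) powr (7/8))\<^sup>2"
        by (simp add: power2_eq_square flip: powr_add)
      finally show ?thesis by (simp add: abs_le_square_iff[symmetric])
    qed
    show "poly_null (\<lambda>n. (\<Sum>i\<in>{1..<n}. Y i w) / real n)"
    proof (rule poly_nullI_eventually[of "1/8"])
      show "eventually (\<lambda>n. \<bar>(\<Sum>i\<in>{1..<n}. Y i w) / real n\<bar>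
          \<le> (1 + 2 * B) * real n powr - (1/8)) sequentially"
        unfolding eventually_sequentially
      proof (intro exI allI impI)
        fix n :: nat assume n: "n \<ge> max 1 (k0\<^sup>2)"
        define k where "k = floor_sqrt n"
        have k1: "k \<ge> 1" "k \<ge> k0" "k\<^sup>2 \<le> n"
          using n mono_floor_sqrt'[of "k0\<^sup>2" n] mono_floor_sqrt'[of 1 n] by (auto simp: k_def)
        have k2: "n < (Suc k)\<^sup>2" using Suc_floor_sqrt_power2_gt[of n] by (simp add: k_def)
        have k3: "1 \<le> k\<^sup>2" using k1 by simp
        have "{1..<n} = {1..<k\<^sup>2} \<union> {k\<^sup>2..<n}" using k1(3) k3 by auto
        then have "T n w = T (k\<^sup>2) w + (\<Sum>i\<in>{k\<^sup>2..<n}. Y i w)"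
          unfolding T_def by (simp add: sum.union_disjoint ivl_disj_int)
        moreover have "\<bar>\<Sum>i\<in>{k\<^sup>2..<n}. Y i w\<bar> \<le> (\<Sum>i\<in>{k\<^sup>2..<n}. B)"
        proof (rule order_trans[OF sum_abs sum_mono])
          fix i assume "i \<in> {k\<^sup>2..<n}"
          then show "\<bar>Y i w\<bar> \<le> B" using bd k3 by auto
        qed
        moreover have "(\<Sum>i\<in>{k\<^sup>2..<n}. B) \<le> 2 * B * real k"
        proof -
          have "n - k\<^sup>2 \<le> 2 * k" using k2 by (simp add: power2_eq_square)
          then have "real (n - k\<^sup>2) \<le> 2 * real k" by linarith
          then have "real (n - k\<^sup>2) * B \<le> 2 * real k * B" using B0 by (rule mult_right_mono)
          then show ?thesis by (simp add: mult_ac)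
        qed
        moreover have "\<bar>T (k\<^sup>2) w\<bar> \<le> real n powr (7/8)"
        proof -
          have "real (k\<^sup>2) powr (7/8) \<le> real n powr (7/8)"
            using k1(3) by (intro powr_mono2) (auto simp: of_nat_le_iff[symmetric] simp del: of_nat_le_iff)
          then show ?thesis using Tk[OF k1(2)] by linarith
        qed
        moreover have "real k \<le> real n powr (7/8)"
        proof -
          have "real k = (real (k\<^sup>2)) powr (1/2)" by (simp add: powr_half_sqrt)
          also have "\<dots> \<le> real n powr (1/2)" using k1(3) by (intro powr_mono2) (auto simp: of_nat_le_iff[symmetric] simp del: of_nat_le_iff)
          also have "\<dots> \<le> real n powr (7/8)" using n by (intro powr_mono) auto
          finally show ?thesis .
        qed
        then have "2 * B * real k \<le> 2 * B * real n powr (7/8)" using B0 by (intro mult_left_mono) auto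
        ultimately have "\<bar>T n w\<bar> \<le> (1 + 2 * B) * real n powr (7/8)" by (simp add: algebra_simps)
        also have "real n powr (7/8) = real n powr - (1/8) * real n"
          using n powr_add[of "real n" "-(1/8)" 1] by simp
        finally show "\<bar>(\<Sum>i\<in>{1..<n}. Y i w) / real n\<bar> \<le> (1 + 2 * B) * real n powr - (1/8)"
          using n unfolding T_def by (simp add: abs_divide pos_divide_le_eq)
      qed
    qed simp
  qed
qed

lemma space_hist [simp]: "space (hist M X t) = space M"
  unfolding hist_def by (intro space_measure_of) auto

lemma subalgebra_hist:
  assumes "\<And>t. t \<ge> 1 \<Longrightarrow> X t \<in> borel_measurable M"
  shows "subalgebra M (hist M X t)"
  unfolding subalgebra_def
proof
  have "(\<Union>i\<in>{1..t}. {X i -` B \<inter> space M | B. B \<in> sets borel}) \<subseteq> sets M"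
    using assms by (auto intro: measurable_sets)
  then show "sets (hist M X t) \<subseteq> sets M"
    unfolding hist_def by (subst sets_measure_of) (auto intro!: sets.sigma_sets_subset)
qed simp

lemma measurable_hist:
  assumes "1 \<le> i" "i \<le> t"
  shows "X i \<in> borel_measurable (hist M X t)"
proof (rule measurableI)
  fix B :: "real set" assume "B \<in> sets borel"
  then have "X i -` B \<inter> space M \<in> (\<Union>i\<in>{1..t}. {X i -` B \<inter> space M | B. B \<in> sets borel})"
    by (intro UN_I[of i] CollectI exI[of _ B] conjI refl) (use assms in simp_all)
  then show "X i -` B \<inter> space (hist M X t) \<in> sets (hist M X t)"
    unfolding space_hist unfolding hist_def by (subst sets_measure_of) auto
qed simp

text \<open>A constant conditional mean makes \<open>g (X\<^sub>i) - m\<close> a martingale difference sequence, and martingale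
  differences are orthogonal.\<close>
lemma (in prob_space) const_cond_mean_average_poly_null:
  fixes X :: "nat \<Rightarrow> 'a \<Rightarrow> real" and g :: "real \<Rightarrow> real"
  assumes Xm: "\<And>t. t \<ge> 1 \<Longrightarrow> X t \<in> borel_measurable M"
    and X01: "\<And>t. t \<ge> 1 \<Longrightarrow> AE w in M. X t w \<in> {0..1}"
    and gm [measurable]: "g \<in> borel_measurable borel"
    and gb: "\<And>x. x \<in> {0..1} \<Longrightarrow> \<bar>g x\<bar> \<le> B"
    and ce: "\<And>t. t \<ge> 1 \<Longrightarrow> AE w in M. real_cond_exp M (hist M X (t - 1)) (\<lambda>w. g (X t w)) w = m"
  shows "AE w in M. poly_null (\<lambda>n. (\<Sum>i\<in>{1..<n}. g (X i w) - m) / real n)"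
proof (rule orthogonal_bounded_average_poly_null)
  have gXm: "(\<lambda>w. g (X i w)) \<in> borel_measurable M" if "i \<ge> 1" for i
    using Xm[OF that] by measurable
  show "(\<lambda>w. g (X i w) - m) \<in> borel_measurable M" if "i \<ge> 1" for i
    using gXm[OF that] by measurable
  have gXb: "AE w in M. \<bar>g (X i w)\<bar> \<le> B" if "i \<ge> 1" for i
    using X01[OF that] by eventually_elim (use gb in auto)
  show bd: "AE w in M. \<bar>g (X i w) - m\<bar> \<le> B + \<bar>m\<bar>" if "i \<ge> 1" for i
    using gXb[OF that] by eventually_elim auto
  show "expectation (\<lambda>w. (g (X i w) - m) * (g (X j w) - m)) = 0" if ij: "1 \<le> i" "i < j" for i j
  proof -
    interpret sub: finite_measure_subalgebra M "hist M X (j - 1)"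
      by unfold_locales (rule subalgebra_hist[OF Xm])
    have j: "j \<ge> 1" using ij by simp
    define Y where "Y w = g (X i w) - m" for w
    have Xi: "X i \<in> borel_measurable (hist M X (j - 1))" by (rule measurable_hist) (use ij in auto)
    have Yh: "Y \<in> borel_measurable (hist M X (j - 1))"
      unfolding Y_def using Xi by measurable
    have Ym: "Y \<in> borel_measurable M" unfolding Y_def using gXm[OF ij(1)] by measurable
    have Yint: "integrable M Y"
      by (rule integrable_const_bound[OF _ Ym, where B = "B + \<bar>m\<bar>"])
         (use bd[OF ij(1)] in \<open>simp add: Y_def\<close>)
    have YgX: "integrable M (\<lambda>w. Y w * g (X j w))"
    proof (rule integrable_const_bound[where B = "(B + \<bar>m\<bar>) * B"])
      show "AE w in M. norm (Y w * g (X j w)) \<le> (B + \<bar>m\<bar>) * B"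
        using bd[OF ij(1)] gXb[OF j]
        by eventually_elim (auto simp: Y_def abs_mult intro!: mult_mono)
      show "(\<lambda>w. Y w * g (X j w)) \<in> borel_measurable M" using Ym gXm[OF j] by measurable
    qed
    have "expectation (\<lambda>w. Y w * g (X j w))
        = expectation (\<lambda>w. Y w * real_cond_exp M (hist M X (j - 1)) (\<lambda>w. g (X j w)) w)"
      by (rule sub.real_cond_exp_intg(2)[symmetric]) (use YgX Yh gXm[OF j] in auto)
    also have "\<dots> = expectation (\<lambda>w. Y w * m)"
      by (rule integral_cong_AE) (use ce[OF j] Ym in auto)
    finally have "expectation (\<lambda>w. Y w * g (X j w)) - expectation (\<lambda>w. Y w * m) = 0" by simp
    then have "expectation (\<lambda>w. Y w * g (X j w) - Y w * m) = 0"
      using YgX Yint by simp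
    then show ?thesis by (simp add: Y_def algebra_simps)
  qed
qed

section \<open>Plug-in weights\<close>

text \<open>The plug-ins in isolation: \<open>Z\<close> stands for the squared deviations of the squared residuals from their
  estimated mean, \<open>m\<close> for the running estimate of \<open>v\<close>, \<open>L n\<close> for \<open>ln (1 / \<delta>\<^sub>n)\<close>, and \<open>W n i\<close> for the
  weight of observation \<open>i\<close> at sample size \<open>n\<close>. A varying level \<open>\<delta>\<^sub>n\<close> covers both confidence limits.\<close>
locale plug_in_weights =
  fixes Z m L :: "nat \<Rightarrow> real" and a b B v \<Lambda> :: real and W :: "nat \<Rightarrow> nat \<Rightarrow> real"
  assumes Z0: "\<And>i. i \<ge> 1 \<Longrightarrow> 0 \<le> Z i" and ZB: "\<And>i. i \<ge> 1 \<Longrightarrow> Z i \<le> B"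
    and a: "0 < a" and b: "0 < b" "b < 1"
    and m_def: "\<And>i. m i = (a + (\<Sum>j\<in>{1..<i}. Z j)) / real i"
    and m_v: "poly_null (\<lambda>i. m i - v)"
    and L: "L \<longlonglongrightarrow> \<Lambda>" and \<Lambda>: "0 < \<Lambda>"
    and W_def: "\<And>n i. W n i = min (sqrt (2 * L n / (m i * real n))) b"
begin

definition S :: "nat \<Rightarrow> real" where "S i = a + (\<Sum>j\<in>{1..<i}. Z j)"

lemma S_Suc: "i \<ge> 1 \<Longrightarrow> S (Suc i) = S i + Z i"
  by (simp add: S_def)

lemma S_mono: "i \<le> j \<Longrightarrow> S i \<le> S j"
  unfolding S_def by (intro add_left_mono sum_mono2) (auto intro: Z0)

lemma S_ge: "a \<le> S i"
  unfolding S_def using Z0 by (auto intro!: sum_nonneg)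

lemma m_eq: "m i = S i / real i"
  by (simp add: m_def S_def)

lemma m_pos: "i \<ge> 1 \<Longrightarrow> 0 < m i"
  using S_ge[of i] a by (simp add: m_eq)

lemma v_nonneg: "0 \<le> v"
proof (rule LIMSEQ_le_const[OF poly_null_tendsto[OF m_v]])
  show "\<exists>N. \<forall>n\<ge>N. 0 \<le> m n" using m_pos by (intro exI[of _ 1]) (auto intro: less_imp_le)
qed

lemma inverse_sqrt_m_le: "i \<ge> 1 \<Longrightarrow> 1 / sqrt (m i) \<le> sqrt (real i) / sqrt a"
proof -
  assume i: "i \<ge> 1"
  have "1 / sqrt (m i) = sqrt (real i) / sqrt (S i)" by (simp add: m_eq real_sqrt_divide)
  also have "\<dots> \<le> sqrt (real i) / sqrt a"
    using S_ge[of i] a by (intro divide_left_mono mult_pos_pos) auto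
  finally show ?thesis .
qed

text \<open>The truncation at \<open>b\<close> costs only a constant factor, because \<open>m i \<ge> a / n\<close> for \<open>i \<le> n\<close>
  already bounds \<open>1 / sqrt (m i)\<close> by a multiple of \<open>sqrt n\<close>.\<close>
lemma weights_bounds:
  obtains k K where "k > 0" "K > 0"
    "eventually (\<lambda>n. \<forall>i\<in>{1..n}. k / sqrt (m i) \<le> sqrt (real n) * W n i \<and>
       sqrt (real n) * W n i \<le> K / sqrt (m i) \<and> 0 < W n i) sequentially"
proof -
  define k where "k = min (sqrt \<Lambda>) (b * sqrt a)"
  define K where "K = 2 * sqrt \<Lambda>"
  have k: "k > 0" using a b \<Lambda> by (simp add: k_def)
  have K: "K > 0" using \<Lambda> by (simp add: K_def)
  have ev1: "eventually (\<lambda>n. L n > \<Lambda> / 2) sequentially"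
    using order_tendstoD(1)[OF L, of "\<Lambda> / 2"] \<Lambda> by simp
  have ev2: "eventually (\<lambda>n. L n < 2 * \<Lambda>) sequentially"
    using order_tendstoD(2)[OF L, of "2 * \<Lambda>"] \<Lambda> by simp
  have "eventually (\<lambda>n. \<forall>i\<in>{1..n}. k / sqrt (m i) \<le> sqrt (real n) * W n i \<and>
       sqrt (real n) * W n i \<le> K / sqrt (m i) \<and> 0 < W n i) sequentially"
    using ev1 ev2
  proof eventually_elim
    case (elim n)
    show ?case
    proof
      fix i assume i: "i \<in> {1..n}"
      have n: "real n > 0" using i by simp
      have mi: "m i > 0" using i m_pos by simp
      have sW: "sqrt (real n) * W n i = min (sqrt (2 * L n) / sqrt (m i)) (b * sqrt (real n))"
        using n unfolding W_def by (simp add: min_mult_distrib_left real_sqrt_mult real_sqrt_divide mult.commute)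
      have 1: "sqrt \<Lambda> / sqrt (m i) \<le> sqrt (2 * L n) / sqrt (m i)"
        using elim mi by (intro divide_right_mono real_sqrt_le_mono) auto
      have 2: "b * sqrt a / sqrt (m i) \<le> b * sqrt (real n)"
      proof -
        have "1 / sqrt (m i) \<le> sqrt (real i) / sqrt a" using i by (intro inverse_sqrt_m_le) auto
        also have "\<dots> \<le> sqrt (real n) / sqrt a" using i a by (intro divide_right_mono) auto
        finally have "(b * sqrt a) * (1 / sqrt (m i)) \<le> (b * sqrt a) * (sqrt (real n) / sqrt a)"
          using a b by (intro mult_left_mono) auto
        then show ?thesis using a by simp
      qed
      have "k / sqrt (m i) \<le> sqrt \<Lambda> / sqrt (m i)" "k / sqrt (m i) \<le> b * sqrt a / sqrt (m i)"
        unfolding k_def using mi by (auto intro!: divide_right_mono)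
      with 1 2 have lo: "k / sqrt (m i) \<le> sqrt (real n) * W n i" unfolding sW by simp
      have "sqrt (2 * L n) \<le> sqrt (4 * \<Lambda>)" using elim by (intro real_sqrt_le_mono) auto
      then have "sqrt (2 * L n) / sqrt (m i) \<le> K / sqrt (m i)"
        unfolding K_def using mi by (intro divide_right_mono) (auto simp: real_sqrt_mult)
      then have hi: "sqrt (real n) * W n i \<le> K / sqrt (m i)" unfolding sW by simp
      have "0 < k / sqrt (m i)" using k mi by simp
      with lo have "0 < sqrt (real n) * W n i" by linarith
      then have "0 < W n i" using n by (simp add: zero_less_mult_iff)
      with lo hi show "k / sqrt (m i) \<le> sqrt (real n) * W n i \<and>
       sqrt (real n) * W n i \<le> K / sqrt (m i) \<and> 0 < W n i" by blast
    qed
  qed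
  then show ?thesis using that k K by blast
qed

text \<open>Monotonicity of \<open>S\<close> gives \<open>1 / sqrt (m i) = sqrt (i / S i) \<ge> i / (sqrt n sqrt (S n))\<close>.\<close>
lemma sum_inverse_sqrt_m_ge:
  assumes n: "n \<ge> 1"
  shows "real n / (2 * sqrt (m n)) \<le> (\<Sum>i\<in>{1..n}. 1 / sqrt (m i))"
proof -
  have Sn: "S n > 0" using S_ge[of n] a by linarith
  have "real n / (2 * sqrt (m n)) \<le> (real n * (real n + 1) / 2) / (sqrt (real n) * sqrt (S n))"
  proof -
    have sm: "sqrt (m n) = sqrt (S n) / sqrt (real n)" by (simp add: m_eq real_sqrt_divide)
    have "real n / (2 * sqrt (m n)) = (real n * real n / 2) / (sqrt (real n) * sqrt (S n))"
      unfolding sm using n Sn by (simp add: divide_simps)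
    also have "\<dots> \<le> (real n * (real n + 1) / 2) / (sqrt (real n) * sqrt (S n))"
      using n Sn by (intro divide_right_mono) auto
    finally show ?thesis .
  qed
  also have "real n * (real n + 1) / 2 = (\<Sum>i\<in>{1..n}. real i)"
    by (induction n) (auto simp: field_simps)
  also have "\<dots> / (sqrt (real n) * sqrt (S n)) = (\<Sum>i\<in>{1..n}. real i / (sqrt (real n) * sqrt (S n)))"
    by (rule sum_divide_distrib)
  also have "\<dots> \<le> (\<Sum>i\<in>{1..n}. 1 / sqrt (m i))"
  proof (rule sum_mono)
    fix i assume i: "i \<in> {1..n}"
    have Si: "S i > 0" using S_ge[of i] a by linarith
    have "real i / (sqrt (real n) * sqrt (S n)) \<le> real i / (sqrt (real i) * sqrt (S i))"
      using i Si S_mono[of i n] Sn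
      by (intro divide_left_mono mult_mono real_sqrt_le_mono mult_pos_pos) auto
    also have "\<dots> = sqrt (real i) / sqrt (S i)" using i by (simp add: real_div_sqrt flip: divide_divide_eq_left)
    also have "\<dots> = 1 / sqrt (m i)" by (simp add: m_eq real_sqrt_divide)
    finally show "real i / (sqrt (real n) * sqrt (S n)) \<le> 1 / sqrt (m i)" .
  qed
  finally show ?thesis .
qed

lemma sum_inverse_sqrt_m_ge_linear:
  obtains k where "k > 0" "\<And>n. n \<ge> 1 \<Longrightarrow> k * real n \<le> (\<Sum>i\<in>{1..n}. 1 / sqrt (m i))"
proof -
  obtain K where K: "K > 0" "\<And>n. n \<ge> 1 \<Longrightarrow> \<bar>m n - v\<bar> \<le> K"
    by (rule poly_null_bounded[OF m_v]) (rule that)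
  define k where "k = 1 / (2 * sqrt (K + v))"
  have k: "k > 0" using K v_nonneg by (simp add: k_def)
  have "k * real n \<le> (\<Sum>i\<in>{1..n}. 1 / sqrt (m i))" if n: "n \<ge> 1" for n
  proof -
    have "m n \<le> K + v" using K(2)[OF n] by linarith
    then have "real n / (2 * sqrt (K + v)) \<le> real n / (2 * sqrt (m n))"
      using m_pos[OF n] K v_nonneg by (intro divide_left_mono mult_pos_pos) auto
    also have "\<dots> \<le> (\<Sum>i\<in>{1..n}. 1 / sqrt (m i))" by (rule sum_inverse_sqrt_m_ge[OF n])
    finally show ?thesis by (simp add: k_def)
  qed
  with k show ?thesis using that by blast
qed

text \<open>For \<open>v = 0\<close> the weights add up to more than \<open>sqrt n\<close>, by a power of \<open>n\<close>. Here the rate of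
  \<open>m\<close> enters.\<close>
lemma sum_inverse_sqrt_m_ge_superlinear:
  assumes "v = 0"
  obtains k e where "k > 0" "e > 0"
    "\<And>n. n \<ge> 1 \<Longrightarrow> k * real n powr (1 + e) \<le> (\<Sum>i\<in>{1..n}. 1 / sqrt (m i))"
proof -
  obtain e K where e: "0 < e" "e \<le> 1" "K > 0"
    and K: "\<And>n. n \<ge> 1 \<Longrightarrow> \<bar>m n - v\<bar> \<le> K * real n powr - e"
    by (rule poly_nullE[OF m_v zero_less_one]) (rule that)
  define k where "k = 1 / (2 * sqrt K)"
  have k: "k > 0" using e by (simp add: k_def)
  have "k * real n powr (1 + e / 2) \<le> (\<Sum>i\<in>{1..n}. 1 / sqrt (m i))" if n: "n \<ge> 1" for n
  proof -
    have "m n \<le> K * real n powr - e" using K[OF n] assms by simp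
    then have "sqrt (m n) \<le> sqrt (K * real n powr - e)" by (rule real_sqrt_le_mono)
    also have "\<dots> = sqrt K * real n powr - (e / 2)"
      by (simp add: real_sqrt_mult powr_powr flip: powr_half_sqrt)
    finally have "sqrt (m n) \<le> sqrt K * real n powr - (e / 2)" .
    then have "real n / (2 * (sqrt K * real n powr - (e / 2))) \<le> real n / (2 * sqrt (m n))"
      using m_pos[OF n] e n by (intro divide_left_mono mult_pos_pos mult_left_mono) auto
    also have "\<dots> \<le> (\<Sum>i\<in>{1..n}. 1 / sqrt (m i))" by (rule sum_inverse_sqrt_m_ge[OF n])
    also have "real n / (2 * (sqrt K * real n powr - (e / 2))) = k * real n powr (1 + e / 2)"
    proof -
      have "real n powr (1 + e / 2) = real n * real n powr (e / 2)" using n by (simp add: powr_add)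
      then show ?thesis unfolding k_def powr_minus by (simp add: inverse_eq_divide)
    qed
    finally show ?thesis .
  qed
  with k e show ?thesis using that[of k "e/2"] by simp
qed

text \<open>The weighted average of \<open>1 / i\<close> beats \<open>1 / sqrt n\<close> by a power of \<open>n\<close>. For \<open>v > 0\<close> the weights are
  comparable to each other and the average is about \<open>ln n / n\<close>. For \<open>v = 0\<close> the bound
  \<open>1 / sqrt (m i) \<le> sqrt (i / a)\<close> only yields the numerator \<open>sqrt n\<close>, which is borderline, and the
  superlinear growth of the denominator decides.\<close>
lemma weighted_harmonic_sum_le:
  obtains e K where "e > 0" "K > 0"
    "eventually (\<lambda>n. (\<Sum>i\<in>{1..n}. W n i / real i)
        \<le> K * real n powr - (1 / 2 + e) * (\<Sum>i\<in>{1..n}. W n i)) sequentially"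
proof -
  obtain k K where k: "k > 0" "K > 0" and
    W: "eventually (\<lambda>n. \<forall>i\<in>{1..n}. k / sqrt (m i) \<le> sqrt (real n) * W n i \<and>
       sqrt (real n) * W n i \<le> K / sqrt (m i) \<and> 0 < W n i) sequentially"
    by (rule weights_bounds) (rule that)
  note goal = that
  \<comment> \<open>Both cases reduce to exponents \<open>p\<close> and \<open>q\<close> for numerator and denominator, at distance above
    \<open>1/2\<close>.\<close>
  have *: thesis if p: "C > 0" "k' > 0" "q - p > 1/2"
    and up: "\<And>n. n \<ge> 1 \<Longrightarrow> (\<Sum>i\<in>{1..n}. 1 / sqrt (m i) / real i) \<le> C * real n powr p"
    and lo: "\<And>n. n \<ge> 1 \<Longrightarrow> k' * real n powr q \<le> (\<Sum>i\<in>{1..n}. 1 / sqrt (m i))" for C k' p q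
  proof (rule goal[of "q - p - 1/2" "K * C / (k * k')"])
    show "eventually (\<lambda>n. (\<Sum>i\<in>{1..n}. W n i / real i)
        \<le> K * C / (k * k') * real n powr - (1 / 2 + (q - p - 1/2)) * (\<Sum>i\<in>{1..n}. W n i)) sequentially"
      using W eventually_ge_at_top[of 1]
    proof eventually_elim
      case (elim n)
      have n: "real n > 0" using elim by simp
      have "sqrt (real n) * (\<Sum>i\<in>{1..n}. W n i / real i)
          = (\<Sum>i\<in>{1..n}. sqrt (real n) * W n i / real i)" by (simp add: sum_distrib_left)
      also have "\<dots> \<le> (\<Sum>i\<in>{1..n}. K / sqrt (m i) / real i)"
        using elim by (intro sum_mono divide_right_mono) auto
      also have "\<dots> = K * (\<Sum>i\<in>{1..n}. 1 / sqrt (m i) / real i)" by (simp add: sum_distrib_left)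
      also have "\<dots> \<le> K * (C * real n powr p)" using k up elim by (intro mult_left_mono) auto
      also have "\<dots> = K * C / (k * k') * real n powr (p - q) * (k * (k' * real n powr q))"
        using k p n by (simp add: powr_diff field_simps)
      also have "\<dots> \<le> K * C / (k * k') * real n powr (p - q) * (sqrt (real n) * (\<Sum>i\<in>{1..n}. W n i))"
      proof (rule mult_left_mono)
        have "k * (k' * real n powr q) \<le> k * (\<Sum>i\<in>{1..n}. 1 / sqrt (m i))"
          using k lo elim by (intro mult_left_mono) auto
        also have "\<dots> = (\<Sum>i\<in>{1..n}. k / sqrt (m i))" by (simp add: sum_distrib_left)
        also have "\<dots> \<le> (\<Sum>i\<in>{1..n}. sqrt (real n) * W n i)" using elim by (intro sum_mono) auto
        finally show "k * (k' * real n powr q) \<le> sqrt (real n) * (\<Sum>i\<in>{1..n}. W n i)"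
          by (simp add: sum_distrib_left)
      qed (use k p in auto)
      finally have "sqrt (real n) * (\<Sum>i\<in>{1..n}. W n i / real i)
          \<le> sqrt (real n) * (K * C / (k * k') * real n powr (p - q) * (\<Sum>i\<in>{1..n}. W n i))"
        by (simp add: mult_ac)
      then have "(\<Sum>i\<in>{1..n}. W n i / real i) \<le> K * C / (k * k') * real n powr (p - q) * (\<Sum>i\<in>{1..n}. W n i)"
        by (rule mult_left_le_imp_le) (use n in simp)
      then show ?case by simp
    qed
  qed (use p k in auto)
  show thesis
  proof (cases "v = 0")
    case True
    obtain k' e where ke: "k' > 0" "e > 0"
      "\<And>n. n \<ge> 1 \<Longrightarrow> k' * real n powr (1 + e) \<le> (\<Sum>i\<in>{1..n}. 1 / sqrt (m i))"
      by (rule sum_inverse_sqrt_m_ge_superlinear[OF True]) (rule that)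
    show ?thesis
    proof (rule *[of "2 / sqrt a" k' "1 + e" "1 / 2"])
      fix n :: nat
      have "(\<Sum>i\<in>{1..n}. 1 / sqrt (m i) / real i) \<le> (\<Sum>i\<in>{1..n}. (1 / sqrt a) * real i powr - (1/2))"
      proof (rule sum_mono)
        fix i assume i: "i \<in> {1..n}"
        have "1 / sqrt (m i) / real i \<le> sqrt (real i) / sqrt a / real i"
          using i by (intro divide_right_mono inverse_sqrt_m_le) auto
        also have "\<dots> = (1 / sqrt a) * (sqrt (real i) / real i)" by simp
        also have "sqrt (real i) / real i = real i powr - (1/2)"
          using i by (simp add: powr_minus powr_half_sqrt field_simps)
        finally show "1 / sqrt (m i) / real i \<le> (1 / sqrt a) * real i powr - (1/2)" .
      qed
      also have "\<dots> = (1 / sqrt a) * (\<Sum>i\<in>{1..n}. real i powr - (1/2))" by (simp add: sum_distrib_left)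
      also have "\<dots> \<le> (1 / sqrt a) * (real n powr (1 - 1/2) / (1 - 1/2))"
        using a by (intro mult_left_mono sum_powr_neg_le) auto
      finally show "(\<Sum>i\<in>{1..n}. 1 / sqrt (m i) / real i) \<le> 2 / sqrt a * real n powr (1 / 2)" by (simp add: mult_ac)
    qed (use ke a in auto)
  next
    case False
    then have v: "v > 0" using v_nonneg by simp
    obtain k0 where k0: "k0 > 0" "\<And>n. n \<ge> 1 \<Longrightarrow> k0 \<le> m n"
      by (rule pos_seq_bounded_below[OF poly_null_tendsto[OF m_v] v]) (rule m_pos, assumption, rule that)
    obtain k' where k': "k' > 0" "\<And>n. n \<ge> 1 \<Longrightarrow> k' * real n \<le> (\<Sum>i\<in>{1..n}. 1 / sqrt (m i))"
      by (rule sum_inverse_sqrt_m_ge_linear) (rule that)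
    show ?thesis
    proof (rule *[of "4 / sqrt k0" k' 1 "1 / 4"])
      fix n :: nat
      have "(\<Sum>i\<in>{1..n}. 1 / sqrt (m i) / real i) \<le> (\<Sum>i\<in>{1..n}. (1 / sqrt k0) * real i powr - (3/4))"
      proof (rule sum_mono)
        fix i assume i: "i \<in> {1..n}"
        have "1 / sqrt (m i) / real i \<le> 1 / sqrt k0 / real i"
          using i k0 m_pos by (intro divide_right_mono divide_left_mono mult_pos_pos) auto
        also have "\<dots> = (1 / sqrt k0) * real i powr - 1" using i by (simp add: powr_minus field_simps)
        also have "\<dots> \<le> (1 / sqrt k0) * real i powr - (3/4)"
          using i k0 by (intro mult_left_mono powr_mono) auto
        finally show "1 / sqrt (m i) / real i \<le> (1 / sqrt k0) * real i powr - (3/4)" .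
      qed
      also have "\<dots> = (1 / sqrt k0) * (\<Sum>i\<in>{1..n}. real i powr - (3/4))" by (simp add: sum_distrib_left)
      also have "\<dots> \<le> (1 / sqrt k0) * (real n powr (1 - 3/4) / (1 - 3/4))"
        using k0 by (intro mult_left_mono sum_powr_neg_le) auto
      finally show "(\<Sum>i\<in>{1..n}. 1 / sqrt (m i) / real i) \<le> 4 / sqrt k0 * real n powr (1 / 4)" by (simp add: mult_ac)
    qed (use k' k0 in auto)
  qed
qed

lemma sqrt_wavg_tendsto_0:
  assumes t: "\<And>\<eta>. \<eta> > 0 \<Longrightarrow> \<exists>K. eventually (\<lambda>n. \<forall>i\<in>{1..n}. 0 \<le> t n i \<and>
      t n i \<le> K * real n powr \<eta> / real i) sequentially"
  shows "(\<lambda>n. sqrt (real n) * wavg (W n) (t n) n) \<longlonglongrightarrow> 0"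
proof -
  obtain k0 K0 where "k0 > 0" "K0 > 0" and
    W: "eventually (\<lambda>n. \<forall>i\<in>{1..n}. k0 / sqrt (m i) \<le> sqrt (real n) * W n i \<and>
       sqrt (real n) * W n i \<le> K0 / sqrt (m i) \<and> 0 < W n i) sequentially"
    by (rule weights_bounds) (rule that)
  obtain e K where e: "e > 0" "K > 0" and
    h: "eventually (\<lambda>n. (\<Sum>i\<in>{1..n}. W n i / real i)
        \<le> K * real n powr - (1 / 2 + e) * (\<Sum>i\<in>{1..n}. W n i)) sequentially"
    by (rule weighted_harmonic_sum_le) (rule that)
  from t[of "e / 2"] e obtain K' where
    K': "eventually (\<lambda>n. \<forall>i\<in>{1..n}. 0 \<le> t n i \<and> t n i \<le> K' * real n powr (e / 2) / real i) sequentially"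
    by auto
  show ?thesis
  proof (rule tendsto_zero_powr_bound)
    show "eventually (\<lambda>n. \<bar>sqrt (real n) * wavg (W n) (t n) n\<bar> \<le> (\<bar>K'\<bar> * K) * real n powr - (e / 2)) sequentially"
      using W h K' eventually_ge_at_top[of 1]
    proof eventually_elim
      case (elim n)
      define H where "H = (\<Sum>i\<in>{1..n}. W n i)"
      have H: "H > 0" unfolding H_def using elim by (intro sum_pos) auto
      have num0: "0 \<le> (\<Sum>i\<in>{1..n}. W n i * t n i)"
        using elim by (intro sum_nonneg mult_nonneg_nonneg) (auto intro: less_imp_le)
      have "(\<Sum>i\<in>{1..n}. W n i * t n i) \<le> (\<Sum>i\<in>{1..n}. W n i * (\<bar>K'\<bar> * real n powr (e / 2) / real i))"
      proof (rule sum_mono)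
        fix i assume i: "i \<in> {1..n}"
        have "t n i \<le> K' * real n powr (e / 2) / real i" using elim i by blast
        also have "\<dots> \<le> \<bar>K'\<bar> * real n powr (e / 2) / real i"
          by (intro divide_right_mono mult_right_mono) auto
        finally show "W n i * t n i \<le> W n i * (\<bar>K'\<bar> * real n powr (e / 2) / real i)"
          using elim i by (intro mult_left_mono) (auto intro: less_imp_le)
      qed
      also have "\<dots> = \<bar>K'\<bar> * real n powr (e / 2) * (\<Sum>i\<in>{1..n}. W n i / real i)"
        by (simp add: sum_distrib_left mult_ac)
      also have "\<dots> \<le> \<bar>K'\<bar> * real n powr (e / 2) * (K * real n powr - (1 / 2 + e) * H)"
        unfolding H_def using elim by (intro mult_left_mono) auto
      finally have "(\<Sum>i\<in>{1..n}. W n i * t n i) / H \<le> \<bar>K'\<bar> * real n powr (e / 2) * (K * real n powr - (1 / 2 + e))"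
        using H by (simp add: divide_le_eq mult_ac)
      then have "sqrt (real n) * wavg (W n) (t n) n
          \<le> sqrt (real n) * (\<bar>K'\<bar> * real n powr (e / 2) * (K * real n powr - (1 / 2 + e)))"
        unfolding wavg_def H_def by (intro mult_left_mono) auto
      also have "\<dots> = (\<bar>K'\<bar> * K) * (real n powr (1/2) * real n powr (e / 2) * real n powr - (1 / 2 + e))"
        by (simp add: powr_half_sqrt mult_ac)
      also have "real n powr (1/2) * real n powr (e / 2) * real n powr - (1 / 2 + e) = real n powr - (e / 2)"
        by (simp flip: powr_add)
      finally have "sqrt (real n) * wavg (W n) (t n) n \<le> (\<bar>K'\<bar> * K) * real n powr - (e / 2)" .
      moreover have "0 \<le> sqrt (real n) * wavg (W n) (t n) n"
        unfolding wavg_def using num0 H by (simp add: H_def)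
      ultimately show ?case by simp
    qed
  qed (use e in simp)
qed

definition rad :: "nat \<Rightarrow> real" where
  "rad n = (L n + (\<Sum>i\<in>{1..n}. psiE (W n i) * Z i)) / (\<Sum>i\<in>{1..n}. W n i)"

lemma W_le: "W n i \<le> b"
  by (simp add: W_def)

text \<open>Since \<open>Z i = S (i + 1) - S i\<close>, the sum is a discrete version of \<open>\<integral> dS / S = ln S\<close>.\<close>
lemma sum_increment_ratio_le:
  "(\<Sum>i\<in>{1..n}. Z i / S i) \<le> (1 + B / a) * ln (S (Suc n) / a)"
proof (induction n)
  case 0 then show ?case using a by (simp add: S_def)
next
  case (Suc n)
  have S1: "S (Suc n) > 0" using S_ge[of "Suc n"] a by linarith
  define u where "u = Z (Suc n) / S (Suc n)"
  have u0: "0 \<le> u" using Z0[of "Suc n"] S1 by (simp add: u_def)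
  have "u \<le> B / a"
    unfolding u_def using Z0[of "Suc n"] ZB[of "Suc n"] S_ge[of "Suc n"] a by (intro frac_le) auto
  have "ln (1 / (1 + u)) \<le> 1 / (1 + u) - 1" using u0 by (intro ln_le_minus_one) auto
  then have "u / (1 + u) \<le> ln (1 + u)" using u0 by (simp add: ln_div field_simps)
  then have "u \<le> (1 + u) * ln (1 + u)" using u0 by (simp add: pos_divide_le_eq mult.commute)
  also have "\<dots> \<le> (1 + B / a) * ln (1 + u)"
    using u0 \<open>u \<le> B / a\<close> by (intro mult_right_mono) auto
  finally have u: "u \<le> (1 + B / a) * ln (1 + u)" .
  have "S (Suc (Suc n)) / a = (S (Suc n) / a) * (1 + u)"
    using S1 a by (simp add: S_Suc u_def field_simps)
  then have "ln (S (Suc (Suc n)) / a) = ln (S (Suc n) / a) + ln (1 + u)"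
    using ln_mult_pos[of "S (Suc n) / a" "1 + u"] S1 a u0 by simp
  then show ?case using Suc u by (simp add: u_def algebra_simps)
qed

lemma S_le: "S (Suc n) \<le> a + real n * B"
proof -
  have "(\<Sum>j\<in>{1..n}. Z j) \<le> (\<Sum>j\<in>{1..n}. B)" by (intro sum_mono ZB) auto
  moreover have "{1..<Suc n} = {1..n}" by auto
  ultimately show ?thesis unfolding S_def by simp
qed

lemma B_nonneg: "0 \<le> B"
  using Z0[of 1] ZB[of 1] by simp

lemma ln_S_le:
  assumes "\<eta> > 0"
  obtains K where "K > 0" "\<And>n. n \<ge> 1 \<Longrightarrow> ln (S (Suc n) / a) \<le> K * real n powr \<eta>"
proof
  define c where "c = 1 + B / a"
  have c: "c \<ge> 1" using a B_nonneg by (simp add: c_def)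
  show "c powr \<eta> / \<eta> > 0" using c assms by simp
  fix n :: nat assume n: "n \<ge> 1"
  have "S (Suc n) / a \<le> c * real n"
  proof -
    have "1 * a \<le> real n * a" using n a by (intro mult_right_mono) auto
    then have "S (Suc n) \<le> real n * a + real n * B" using S_le[of n] by linarith
    then show ?thesis using a by (simp add: c_def field_simps)
  qed
  moreover have "S (Suc n) / a > 0" using S_ge[of "Suc n"] a by simp
  ultimately have "ln (S (Suc n) / a) \<le> ln (c * real n)" by (subst ln_le_cancel_iff) auto
  also have "\<dots> \<le> (c * real n) powr \<eta> / \<eta>"
  proof (rule ln_powr_bound[OF _ assms])
    have "1 * 1 \<le> c * real n" using c n by (intro mult_mono) auto
    then show "1 \<le> c * real n" by simp
  qed
  also have "\<dots> = c powr \<eta> / \<eta> * real n powr \<eta>" using c by (simp add: powr_mult)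
  finally show "ln (S (Suc n) / a) \<le> c powr \<eta> / \<eta> * real n powr \<eta>" .
qed

text \<open>The numerator grows at most logarithmically by \<open>sum_increment_ratio_le\<close>, whereas the total weight
  times \<open>1 / sqrt n\<close> grows polynomially by \<open>sum_inverse_sqrt_m_ge_superlinear\<close>.\<close>
lemma rad_tendsto_degenerate:
  assumes "v = 0"
  shows "(\<lambda>n. sqrt (real n) * rad n) \<longlonglongrightarrow> 0"
proof -
  obtain k K where k: "k > 0" "K > 0" and
    W: "eventually (\<lambda>n. \<forall>i\<in>{1..n}. k / sqrt (m i) \<le> sqrt (real n) * W n i \<and>
       sqrt (real n) * W n i \<le> K / sqrt (m i) \<and> 0 < W n i) sequentially"
    by (rule weights_bounds) (rule that)
  obtain k' e where e: "k' > 0" "e > 0"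
    and lo: "\<And>n. n \<ge> 1 \<Longrightarrow> k' * real n powr (1 + e) \<le> (\<Sum>i\<in>{1..n}. 1 / sqrt (m i))"
    by (rule sum_inverse_sqrt_m_ge_superlinear[OF assms]) (rule that)
  have e2: "e / 2 > 0" using e by simp
  obtain K' where K': "K' > 0" and lnS: "\<And>n. n \<ge> 1 \<Longrightarrow> ln (S (Suc n) / a) \<le> K' * real n powr (e / 2)"
    by (rule ln_S_le[OF e2]) (rule that)
  define C where "C = 1 / 2 + b / (1 - b)"
  have C: "C > 0" unfolding C_def using b by (intro add_pos_pos divide_pos_pos) auto
  define A where "A = C * K\<^sup>2 * (1 + B / a) * K'"
  have A: "A \<ge> 0" using C K' a B_nonneg by (simp add: A_def)
  have psi: "psiE l \<le> C * l\<^sup>2" if "0 \<le> l" "l \<le> b" for l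
  proof -
    have "psiE l \<le> l\<^sup>2 / 2 + l ^ 3 / (1 - b)" using psiE_bounds(2)[OF that b(2)] .
    also have "l ^ 3 / (1 - b) = (l / (1 - b)) * l\<^sup>2" by (simp add: power3_eq_cube power2_eq_square)
    also have "\<dots> \<le> (b / (1 - b)) * l\<^sup>2"
      using that b by (intro mult_right_mono divide_right_mono) auto
    finally show ?thesis by (simp add: C_def algebra_simps)
  qed
  have "eventually (\<lambda>n. L n < 2 * \<Lambda>) sequentially"
    using order_tendstoD(2)[OF L, of "2 * \<Lambda>"] \<Lambda> by simp
  moreover have "eventually (\<lambda>n. 0 < L n) sequentially"
    using order_tendstoD(1)[OF L \<Lambda>] .
  ultimately have "eventually (\<lambda>n. \<bar>sqrt (real n) * rad n\<bar> \<le> (2 * \<Lambda> + A) / (k * k') * real n powr - (e / 2)) sequentially"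
    using W eventually_ge_at_top[of 1]
  proof eventually_elim
    case (elim n)
    have n: "real n > 0" "real n \<ge> 1" using elim by auto
    define H where "H = (\<Sum>i\<in>{1..n}. W n i)"
    define N where "N = (\<Sum>i\<in>{1..n}. psiE (W n i) * Z i)"
    have W0: "0 \<le> W n i" if "i \<in> {1..n}" for i using elim that by (auto intro: less_imp_le)
    have N0: "0 \<le> N"
      unfolding N_def
    proof (intro sum_nonneg mult_nonneg_nonneg)
      fix i assume i: "i \<in> {1..n}"
      have "0 \<le> (W n i)\<^sup>2 / 2" by simp
      also have "\<dots> \<le> psiE (W n i)" by (rule psiE_bounds(1)[OF W0[OF i] W_le b(2)])
      finally show "0 \<le> psiE (W n i)" .
      show "0 \<le> Z i" using Z0 i by simp
    qed
    have "N \<le> (\<Sum>i\<in>{1..n}. C * K\<^sup>2 * (Z i / S i))"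
      unfolding N_def
    proof (rule sum_mono)
      fix i assume i: "i \<in> {1..n}"
      have mi: "m i > 0" using i m_pos by simp
      have Si: "S i > 0" using S_ge[of i] a by linarith
      have "(sqrt (real n) * W n i)\<^sup>2 \<le> (K / sqrt (m i))\<^sup>2"
        using elim i W0[OF i] by (intro power_mono) auto
      then have "real n * (W n i)\<^sup>2 \<le> K\<^sup>2 / m i"
        using n mi by (simp add: power_mult_distrib power_divide)
      then have "(W n i)\<^sup>2 \<le> K\<^sup>2 / m i / real n"
        by (subst pos_le_divide_eq) (use n in \<open>simp_all add: mult.commute\<close>)
      also have "\<dots> = K\<^sup>2 / S i * (real i / real n)" using i by (simp add: m_eq)
      also have "\<dots> \<le> K\<^sup>2 / S i * 1" using i Si by (intro mult_left_mono) auto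
      finally have W2: "(W n i)\<^sup>2 \<le> K\<^sup>2 / S i" by simp
      have "psiE (W n i) \<le> C * (W n i)\<^sup>2" by (rule psi[OF W0[OF i] W_le])
      also have "\<dots> \<le> C * (K\<^sup>2 / S i)" using C W2 by (intro mult_left_mono) auto
      finally have "psiE (W n i) * Z i \<le> C * (K\<^sup>2 / S i) * Z i"
        using Z0 i by (intro mult_right_mono) auto
      then show "psiE (W n i) * Z i \<le> C * K\<^sup>2 * (Z i / S i)" by simp
    qed
    also have "\<dots> = C * K\<^sup>2 * (\<Sum>i\<in>{1..n}. Z i / S i)" by (rule sum_distrib_left[symmetric])
    also have "\<dots> \<le> C * K\<^sup>2 * ((1 + B / a) * ln (S (Suc n) / a))"
      using C by (intro mult_left_mono sum_increment_ratio_le) auto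
    also have "\<dots> \<le> C * K\<^sup>2 * ((1 + B / a) * (K' * real n powr (e / 2)))"
      using C a B_nonneg elim by (intro mult_left_mono lnS) auto
    finally have N: "N \<le> A * real n powr (e / 2)" by (simp add: A_def mult.assoc)
    have "1 \<le> real n powr (e / 2)" using n e by (intro ge_one_powr_ge_zero) auto
    then have "2 * \<Lambda> * 1 \<le> 2 * \<Lambda> * real n powr (e / 2)" using \<Lambda> by (intro mult_left_mono) auto
    then have num: "L n + N \<le> (2 * \<Lambda> + A) * real n powr (e / 2)"
      unfolding distrib_right using N elim by linarith
    have "k * (k' * real n powr (1 + e)) \<le> k * (\<Sum>i\<in>{1..n}. 1 / sqrt (m i))"
      using k lo elim by (intro mult_left_mono) auto
    also have "\<dots> = (\<Sum>i\<in>{1..n}. k / sqrt (m i))" by (simp add: sum_distrib_left)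
    also have "\<dots> \<le> (\<Sum>i\<in>{1..n}. sqrt (real n) * W n i)" using elim by (intro sum_mono) auto
    finally have den: "k * k' * real n powr (1 + e) \<le> sqrt (real n) * H"
      by (simp add: H_def sum_distrib_left mult.assoc)
    have den0: "0 < k * k' * real n powr (1 + e)" using k e n by simp
    have "sqrt (real n) * rad n = sqrt (real n) * ((L n + N) / H)"
      by (simp add: rad_def H_def N_def)
    also have "\<dots> = (sqrt (real n) * sqrt (real n)) * (L n + N) / (sqrt (real n) * H)"
      using n by (simp del: real_sqrt_mult_self)
    also have "\<dots> = real n * (L n + N) / (sqrt (real n) * H)" by simp
    also have "\<dots> \<le> real n * ((2 * \<Lambda> + A) * real n powr (e / 2)) / (k * k' * real n powr (1 + e))"
      using num den den0 n elim N0 A \<Lambda> by (intro frac_le mult_left_mono mult_nonneg_nonneg) auto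
    also have "\<dots> = (2 * \<Lambda> + A) / (k * k') * (real n powr 1 * real n powr (e / 2) / real n powr (1 + e))"
      using n by simp
    also have "real n powr 1 * real n powr (e / 2) / real n powr (1 + e) = real n powr - (e / 2)"
      unfolding powr_add[symmetric] powr_diff[symmetric] by simp
    finally have "sqrt (real n) * rad n \<le> (2 * \<Lambda> + A) / (k * k') * real n powr - (e / 2)" .
    moreover have "0 \<le> sqrt (real n) * rad n"
    proof -
      have "0 \<le> H" unfolding H_def by (intro sum_nonneg W0)
      then show ?thesis using N0 elim by (simp add: rad_def H_def N_def)
    qed
    ultimately show ?case by simp
  qed
  with e2 show ?thesis by (rule tendsto_zero_powr_bound)
qed

text \<open>Now \<open>m\<close> is bounded away from \<open>0\<close>, so the truncation is eventually inactive. With \<open>P\<close> and \<open>Q\<close> the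
  averages of \<open>1 / sqrt (m i)\<close> and \<open>Z i / m i\<close>, and \<open>E\<close> the error of \<open>psiE l \<approx> l\<^sup>2 / 2\<close>, the scaled radius
  is \<open>(L + L Q + E) / (sqrt (2 L) P)\<close>.\<close>
lemma rad_tendsto_nondegenerate:
  assumes "v > 0"
  shows "(\<lambda>n. sqrt (real n) * rad n) \<longlonglongrightarrow> sqrt (2 * v * \<Lambda>)"
proof -
  obtain k0 where k0: "k0 > 0" "\<And>n. n \<ge> 1 \<Longrightarrow> k0 \<le> m n"
    by (rule pos_seq_bounded_below[OF poly_null_tendsto[OF m_v] assms]) (rule m_pos, assumption, rule that)
  define P where "P n = (\<Sum>i\<in>{1..n}. 1 / sqrt (m i)) / real n" for n
  define Q where "Q n = (\<Sum>i\<in>{1..n}. Z i / m i) / real n" for n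
  define E where "E n = (\<Sum>i\<in>{1..n}. psiE (W n i) * Z i) - L n * Q n" for n
  have P: "P \<longlonglongrightarrow> 1 / sqrt v"
    unfolding P_def
  proof (rule average_tendsto)
    have "poly_null (\<lambda>n. - (1 / (sqrt (m n) * sqrt v * (sqrt (m n) + sqrt v))) * (m n - v))"
    proof (rule poly_null_mult_bounded[OF m_v])
      fix n :: nat assume n: "n \<ge> 1"
      have "1 / (sqrt (m n) * sqrt v * (sqrt (m n) + sqrt v)) \<le> 1 / (sqrt k0 * sqrt v * (sqrt k0 + sqrt v))"
        using k0(1) k0(2)[OF n] assms
        by (intro divide_left_mono mult_mono add_mono mult_pos_pos add_pos_pos real_sqrt_le_mono) auto
      then show "\<bar>- (1 / (sqrt (m n) * sqrt v * (sqrt (m n) + sqrt v)))\<bar> \<le> 1 / (sqrt k0 * sqrt v * (sqrt k0 + sqrt v))"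
        using m_pos[OF n] assms by simp
    qed
    then show "poly_null (\<lambda>n. 1 / sqrt (m n) - 1 / sqrt v)"
    proof (rule poly_null_cong)
      fix n :: nat assume n: "n \<ge> 1"
      define p q where "p = sqrt (m n)" and "q = sqrt v"
      have pq: "p > 0" "q > 0" using m_pos[OF n] assms by (auto simp: p_def q_def)
      have "m n = p * p" "v = q * q" using m_pos[OF n] assms by (auto simp: p_def q_def)
      then have "- (1 / (p * q * (p + q))) * (m n - v) = - (1 / (p * q * (p + q))) * ((p + q) * (p - q))"
        by (simp add: algebra_simps)
      also have "\<dots> = 1 / p - 1 / q" using pq add_pos_pos[OF pq] by (simp add: divide_simps)
      finally show "- (1 / (sqrt (m n) * sqrt v * (sqrt (m n) + sqrt v))) * (m n - v) = 1 / sqrt (m n) - 1 / sqrt v"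
        by (simp add: p_def q_def)
    qed
  qed
  have avgZ: "(\<lambda>n. (\<Sum>i\<in>{1..n}. Z i) / real n) \<longlonglongrightarrow> v"
  proof -
    have "(\<lambda>n. m (Suc n) * (1 + 1 / real n) - a / real n) \<longlonglongrightarrow> v * (1 + 0) - 0"
      by (intro tendsto_intros LIMSEQ_Suc[OF poly_null_tendsto[OF m_v]] lim_const_over_n)
    then have "(\<lambda>n. m (Suc n) * (1 + 1 / real n) - a / real n) \<longlonglongrightarrow> v" by simp
    moreover have "eventually (\<lambda>n. m (Suc n) * (1 + 1 / real n) - a / real n = (\<Sum>i\<in>{1..n}. Z i) / real n) sequentially"
      using eventually_ge_at_top[of 1]
    proof eventually_elim
      case (elim n)
      have n: "real n > 0" using elim by simp
      have "{1..<Suc n} = {1..n}" by auto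
      then have "m (Suc n) * real (Suc n) = a + (\<Sum>i\<in>{1..n}. Z i)" by (simp add: m_def)
      moreover have "1 + 1 / real n = real (Suc n) / real n" using n by (simp add: field_simps)
      ultimately have "m (Suc n) * (1 + 1 / real n) = (a + (\<Sum>i\<in>{1..n}. Z i)) / real n" by simp
      then show ?case by (simp add: add_divide_distrib)
    qed
    ultimately show ?thesis by (rule Lim_transform_eventually)
  qed
  have Q: "Q \<longlonglongrightarrow> 1"
  proof -
    have "poly_null (\<lambda>n. - (Z n / (m n * v)) * (m n - v))"
    proof (rule poly_null_mult_bounded[OF m_v])
      fix n :: nat assume n: "n \<ge> 1"
      have "Z n / (m n * v) \<le> B / (k0 * v)"
        using k0(1) k0(2)[OF n] assms Z0[OF n] ZB[OF n] by (intro frac_le mult_mono) auto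
      then show "\<bar>- (Z n / (m n * v))\<bar> \<le> B / (k0 * v)" using m_pos[OF n] assms Z0[OF n] by simp
    qed
    then have "poly_null (\<lambda>n. (Z n / m n - Z n / v) - 0)"
    proof (rule poly_null_cong)
      fix n :: nat assume n: "n \<ge> 1"
      show "- (Z n / (m n * v)) * (m n - v) = (Z n / m n - Z n / v) - 0"
        using m_pos[OF n] assms by (simp add: divide_simps) (simp add: algebra_simps)
    qed
    from average_tendsto[OF this]
    have "(\<lambda>n. (\<Sum>i\<in>{1..n}. Z i / m i - Z i / v) / real n + (\<Sum>i\<in>{1..n}. Z i) / real n / v) \<longlonglongrightarrow> 0 + v / v"
      using assms by (intro tendsto_add tendsto_divide avgZ tendsto_const) auto
    moreover have "(\<Sum>i\<in>{1..n}. Z i / m i - Z i / v) / real n + (\<Sum>i\<in>{1..n}. Z i) / real n / v = Q n" for n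
      by (simp add: Q_def sum_subtractf diff_divide_distrib sum_divide_distrib[symmetric] mult.commute)
    ultimately show ?thesis using assms by simp
  qed
  have L2: "eventually (\<lambda>n. L n < 2 * \<Lambda>) sequentially"
    using order_tendstoD(2)[OF L, of "2 * \<Lambda>"] \<Lambda> by simp
  have L1: "eventually (\<lambda>n. 0 < L n) sequentially"
    using order_tendstoD(1)[OF L \<Lambda>] .
  have Weq: "eventually (\<lambda>n. \<forall>i\<in>{1..n}. W n i = sqrt (2 * L n) / sqrt (m i) / sqrt (real n)) sequentially"
  proof -
    have "(\<lambda>n. 4 * \<Lambda> / (k0 * b\<^sup>2) / real n) \<longlonglongrightarrow> 0" by (rule lim_const_over_n)
    then have "eventually (\<lambda>n. 4 * \<Lambda> / (k0 * b\<^sup>2) / real n < 1) sequentially"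
      by (rule order_tendstoD) simp
    then show ?thesis using L1 L2 eventually_ge_at_top[of 1]
    proof eventually_elim
      case (elim n)
      have n: "real n > 0" using elim by simp
      show ?case
      proof
        fix i assume i: "i \<in> {1..n}"
        have "2 * L n / (m i * real n) \<le> 4 * \<Lambda> / (k0 * real n)"
          using elim i k0 n by (intro frac_le mult_right_mono mult_pos_pos) auto
        also have "\<dots> \<le> b\<^sup>2" using elim(1) n k0 b by (simp add: field_simps)
        finally have "sqrt (2 * L n / (m i * real n)) \<le> b" using b by (intro real_le_lsqrt) auto
        then show "W n i = sqrt (2 * L n) / sqrt (m i) / sqrt (real n)"
          by (simp add: W_def real_sqrt_divide real_sqrt_mult)
      qed
    qed
  qed
  have E: "E \<longlonglongrightarrow> 0"
  proof -
    define A where "A = (sqrt (4 * \<Lambda>) / sqrt k0) ^ 3 * B / (1 - b)"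
    have "eventually (\<lambda>n. \<bar>E n\<bar> \<le> A * real n powr - (1/2)) sequentially"
      using Weq L1 L2 eventually_ge_at_top[of 1]
    proof eventually_elim
      case (elim n)
      have n: "real n > 0" using elim by simp
      have "E n = (\<Sum>i\<in>{1..n}. psiE (W n i) * Z i - L n * (Z i / m i) / real n)"
        by (simp add: E_def Q_def sum_subtractf sum_distrib_left sum_divide_distrib)
      also have "\<bar>\<dots>\<bar> \<le> (\<Sum>i\<in>{1..n}. A / (sqrt (real n) ^ 3))"
      proof (rule order_trans[OF sum_abs sum_mono])
        fix i assume i: "i \<in> {1..n}"
        have mi: "m i > 0" "k0 \<le> m i" using i m_pos k0 by auto
        have Wi: "W n i = sqrt (2 * L n) / sqrt (m i) / sqrt (real n)" using elim i by blast
        have W0: "0 \<le> W n i" unfolding Wi using elim mi by simp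
        have W2: "(W n i)\<^sup>2 / 2 = L n / m i / real n"
          unfolding Wi using elim mi n by (simp add: power_divide power_mult_distrib)
        have W3: "W n i \<le> sqrt (4 * \<Lambda>) / sqrt k0 / sqrt (real n)"
          unfolding Wi using elim mi n k0
          by (intro divide_right_mono frac_le real_sqrt_le_mono) auto
        have "psiE (W n i) * Z i - L n * (Z i / m i) / real n = (psiE (W n i) - (W n i)\<^sup>2 / 2) * Z i"
          unfolding W2 by (simp add: algebra_simps)
        also have "\<bar>\<dots>\<bar> \<le> ((W n i) ^ 3 / (1 - b)) * B"
          unfolding abs_mult using psiE_bounds[OF W0 W_le b(2)] Z0[of i] ZB[of i] i W0 b
          by (intro mult_mono) auto
        also have "\<dots> \<le> ((sqrt (4 * \<Lambda>) / sqrt k0 / sqrt (real n)) ^ 3 / (1 - b)) * B"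
          using W0 W3 b B_nonneg by (intro mult_right_mono divide_right_mono power_mono) auto
        also have "\<dots> = A / (sqrt (real n) ^ 3)" by (simp add: A_def power_divide power_mult_distrib)
        finally show "\<bar>psiE (W n i) * Z i - L n * (Z i / m i) / real n\<bar> \<le> A / (sqrt (real n) ^ 3)" .
      qed
      also have "\<dots> = A / sqrt (real n)" using n by (simp add: power3_eq_cube)
      also have "\<dots> = A * real n powr - (1/2)" by (simp add: powr_minus powr_half_sqrt inverse_eq_divide)
      finally show ?case .
    qed
    then show ?thesis by (rule tendsto_zero_powr_bound[rotated]) simp
  qed
  have "(\<lambda>n. (L n + L n * Q n + E n) / (sqrt (2 * L n) * P n)) \<longlonglongrightarrow> (\<Lambda> + \<Lambda> * 1 + 0) / (sqrt (2 * \<Lambda>) * (1 / sqrt v))"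
    using assms \<Lambda> by (intro tendsto_intros L Q E P) auto
  moreover have "(\<Lambda> + \<Lambda> * 1 + 0) / (sqrt (2 * \<Lambda>) * (1 / sqrt v)) = sqrt (2 * v * \<Lambda>)"
  proof -
    have 1: "sqrt (2 * v * \<Lambda>) = sqrt (2 * \<Lambda>) * sqrt v" by (simp add: real_sqrt_mult)
    have 2: "\<Lambda> + \<Lambda> * 1 + 0 = sqrt (2 * \<Lambda>) * sqrt (2 * \<Lambda>)" using \<Lambda> by simp
    show ?thesis unfolding 1 2 using \<Lambda> assms by (simp del: real_sqrt_mult_self)
  qed
  moreover have "eventually (\<lambda>n. (L n + L n * Q n + E n) / (sqrt (2 * L n) * P n) = sqrt (real n) * rad n) sequentially"
    using Weq eventually_ge_at_top[of 1]
  proof eventually_elim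
    case (elim n)
    have n: "real n > 0" using elim by simp
    have "(\<Sum>i\<in>{1..n}. W n i) = (\<Sum>i\<in>{1..n}. sqrt (2 * L n) / sqrt (real n) * (1 / sqrt (m i)))"
      using elim by (intro sum.cong) auto
    also have "\<dots> = sqrt (2 * L n) / sqrt (real n) * (\<Sum>i\<in>{1..n}. 1 / sqrt (m i))"
      by (rule sum_distrib_left[symmetric])
    also have "\<dots> = sqrt (2 * L n) * P n * (real n / sqrt (real n))"
      using n by (simp add: P_def)
    finally have H: "(\<Sum>i\<in>{1..n}. W n i) = sqrt (real n) * (sqrt (2 * L n) * P n)"
      by (simp add: real_div_sqrt)
    have "L n + L n * Q n + E n = L n + (\<Sum>i\<in>{1..n}. psiE (W n i) * Z i)" by (simp add: E_def)
    then show ?case unfolding rad_def H using n by simp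
  qed
  ultimately show ?thesis using Lim_transform_eventually by fastforce
qed

lemma rad_tendsto: "(\<lambda>n. sqrt (real n) * rad n) \<longlonglongrightarrow> sqrt (2 * v * \<Lambda>)"
  using rad_tendsto_degenerate rad_tendsto_nondegenerate v_nonneg by (cases "v = 0") auto

end

section \<open>Consistency of the estimators along a path\<close>

text \<open>A single sample path on which the three averages obey their rates; almost every path is
  of this kind. The parameter \<open>s\<close> is the conditional variance \<open>\<sigma>\<^sup>2\<close>.\<close>
locale regular_path =
  fixes x :: "nat \<Rightarrow> real" and c :: tuning and f :: mean_form and \<alpha> \<mu> s v :: real
  assumes x01: "\<And>i. i \<ge> 1 \<Longrightarrow> x i \<in> {0..1}"
    and mean1: "poly_null (\<lambda>n. (\<Sum>i\<in>{1..<n}. x i - \<mu>) / real n)"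
    and mean2: "poly_null (\<lambda>n. (\<Sum>i\<in>{1..<n}. (x i - \<mu>)\<^sup>2 - s) / real n)"
    and mean4: "poly_null (\<lambda>n. (\<Sum>i\<in>{1..<n}. ((x i - \<mu>)\<^sup>2 - s)\<^sup>2 - v) / real n)"
    and degenerate: "\<And>i. s = 0 \<Longrightarrow> i \<ge> 1 \<Longrightarrow> x i = \<mu>"
    and \<alpha>: "0 < \<alpha>" "\<alpha> < 1" and adm: "admissible c"
begin

abbreviation w :: "nat \<Rightarrow> real" where "w \<equiv> lam_tilde c \<alpha> x"

lemma tuning_pos: "0 < c1 c" "c1 c < 1" "0 < c2 c" "0 < c3 c" "0 < c5 c"
  using adm unfolding admissible_def by auto

lemma ln_2_over_\<alpha>: "0 < ln (2 / \<alpha>)"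
  using \<alpha> by (intro ln_gt_zero) (simp add: field_simps)

lemma dev_bound: "i \<ge> 1 \<Longrightarrow> \<bar>x i - \<mu>\<bar> \<le> 1 + \<bar>\<mu>\<bar>"
  using x01[of i] by auto

lemma mu_bar_rate: "poly_null (\<lambda>t. mu_bar c x t - \<mu>)"
  unfolding mu_bar_def by (rule poly_null_mean_perturb[OF mean1]) (simp add: poly_null_zero)

lemma sigma2_hat_rate: "poly_null (\<lambda>t. sigma2_hat c x t - s)"
  unfolding sigma2_hat_def
proof (rule poly_null_mean_perturb[OF mean2])
  have "poly_null (\<lambda>i. - 1 * (mu_bar c x i - \<mu>))" by (rule poly_null_cmult[OF mu_bar_rate])
  then have "poly_null (\<lambda>i. (x i - mu_bar c x i) - (x i - \<mu>))" by (rule poly_null_cong) simp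
  then show "poly_null (\<lambda>i. (x i - mu_bar c x i)\<^sup>2 - (x i - \<mu>)\<^sup>2)"
    by (rule poly_null_power2_diff[OF _ dev_bound])
qed

lemma sigma2_hat_pos: "i \<ge> 1 \<Longrightarrow> 0 < sigma2_hat c x i"
  unfolding sigma2_hat_def using tuning_pos by (intro divide_pos_pos add_pos_nonneg sum_nonneg) auto

lemma s_nonneg: "0 \<le> s"
proof (rule LIMSEQ_le_const[OF poly_null_tendsto[OF sigma2_hat_rate]])
  show "\<exists>N. \<forall>n\<ge>N. 0 \<le> sigma2_hat c x n"
    using sigma2_hat_pos by (intro exI[of _ 1]) (auto intro: less_imp_le)
qed

lemma w_eq: "i \<ge> 1 \<Longrightarrow> w i = min (sqrt (2 * ln (2 / \<alpha>) /
    ((c3 c + (\<Sum>j\<in>{1..<i}. (x j - mu_bar c x j)\<^sup>2)) * ln (1 + real i)))) (c5 c)"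
  by (simp add: lam_tilde_def sigma2_hat_def)

lemma w_pos: "i \<ge> 1 \<Longrightarrow> 0 < w i"
  unfolding lam_tilde_def using sigma2_hat_pos[of i] ln_2_over_\<alpha> tuning_pos by simp

lemma w_le_c5: "w i \<le> c5 c"
  by (simp add: lam_tilde_def)

text \<open>The estimated variance at time \<open>i\<close> fluctuates, but multiplied by \<open>i\<close> it is a growing sum of
  squares.\<close>
lemma w_antimono:
  assumes i: "i \<ge> 1"
  shows "w (Suc i) \<le> w i"
proof -
  define G where "G i = c3 c + (\<Sum>j\<in>{1..<i}. (x j - mu_bar c x j)\<^sup>2)" for i
  have G: "G i \<le> G (Suc i)" using i by (simp add: G_def)
  have G0: "0 < G i" unfolding G_def using tuning_pos by (intro add_pos_nonneg sum_nonneg) auto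
  have "2 * ln (2 / \<alpha>) / (G (Suc i) * ln (1 + real (Suc i))) \<le> 2 * ln (2 / \<alpha>) / (G i * ln (1 + real i))"
    using G G0 i ln_2_over_\<alpha> by (intro divide_left_mono mult_mono mult_pos_pos) auto
  then show ?thesis using i unfolding w_eq[OF i] w_eq[OF le_SucI[OF i]] G_def[symmetric]
    by (intro min.mono real_sqrt_le_mono) auto
qed

text \<open>The logarithm in \<open>lam_tilde\<close> is absorbed into an arbitrarily small power.\<close>
lemma w_ge:
  assumes \<eta>: "\<eta> > 0"
  obtains k where "k > 0" "\<And>i. i \<ge> 1 \<Longrightarrow> k * real i powr - (1 / 2 + \<eta>) \<le> w i"
proof -
  obtain B where B: "B > 0" "\<And>i. i \<ge> 1 \<Longrightarrow> \<bar>sigma2_hat c x i - s\<bar> \<le> B"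
    by (rule poly_null_bounded[OF sigma2_hat_rate]) (rule that)
  define C where "C = 2 powr (2 * \<eta>) / (2 * \<eta>)"
  have C: "C > 0" using \<eta> by (simp add: C_def)
  have BC: "(B + s) * C > 0" using B C s_nonneg by simp
  define k where "k = min (sqrt (2 * ln (2 / \<alpha>) / ((B + s) * C))) (c5 c)"
  have k: "k > 0" using BC ln_2_over_\<alpha> tuning_pos by (simp add: k_def)
  have "k * real i powr - (1 / 2 + \<eta>) \<le> w i" if i: "i \<ge> 1" for i
  proof -
    define p where "p = real i powr - (1 / 2 + \<eta>)"
    have p: "0 < p" "p \<le> 1" using i \<eta> powr_mono[of "- (1 / 2 + \<eta>)" 0 "real i"] by (auto simp: p_def)
    have pp: "p\<^sup>2 = 1 / (real i * real i powr (2 * \<eta>))"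
    proof -
      have "p\<^sup>2 = real i powr (- (1 + 2 * \<eta>))"
        by (simp add: p_def power2_eq_square flip: powr_add)
      also have "\<dots> = 1 / (real i powr (1 + 2 * \<eta>))" unfolding powr_minus by (simp add: inverse_eq_divide)
      finally show ?thesis using i by (simp add: powr_add)
    qed
    have "ln (1 + real i) \<le> (1 + real i) powr (2 * \<eta>) / (2 * \<eta>)"
      using \<eta> by (intro ln_powr_bound) auto
    also have "\<dots> \<le> (2 * real i) powr (2 * \<eta>) / (2 * \<eta>)"
      using i \<eta> by (intro divide_right_mono powr_mono2) auto
    also have "\<dots> = C * real i powr (2 * \<eta>)" by (simp add: C_def powr_mult)
    finally have ln: "ln (1 + real i) \<le> C * real i powr (2 * \<eta>)" .
    have "sigma2_hat c x i * real i * ln (1 + real i) \<le> (B + s) * real i * (C * real i powr (2 * \<eta>))"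
      using B(2)[OF i] B(1) s_nonneg ln sigma2_hat_pos[OF i] i by (intro mult_mono) auto
    also have "\<dots> = ((B + s) * C) * (real i * real i powr (2 * \<eta>))" by simp
    finally have "2 * ln (2 / \<alpha>) / (((B + s) * C) * (real i * real i powr (2 * \<eta>)))
        \<le> 2 * ln (2 / \<alpha>) / (sigma2_hat c x i * real i * ln (1 + real i))"
      using sigma2_hat_pos[OF i] i ln_2_over_\<alpha> BC B(1) C s_nonneg by (intro divide_left_mono mult_pos_pos) auto
    then have "2 * ln (2 / \<alpha>) / ((B + s) * C) * p\<^sup>2 \<le> 2 * ln (2 / \<alpha>) / (sigma2_hat c x i * real i * ln (1 + real i))"
      by (simp add: pp)
    then have "sqrt (2 * ln (2 / \<alpha>) / ((B + s) * C) * p\<^sup>2) \<le> sqrt (2 * ln (2 / \<alpha>) / (sigma2_hat c x i * real i * ln (1 + real i)))"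
      by (rule real_sqrt_le_mono)
    moreover have "sqrt (2 * ln (2 / \<alpha>) / ((B + s) * C) * p\<^sup>2) = sqrt (2 * ln (2 / \<alpha>) / ((B + s) * C)) * p"
      using p unfolding real_sqrt_mult by simp
    moreover have "k * p \<le> sqrt (2 * ln (2 / \<alpha>) / ((B + s) * C)) * p"
      unfolding k_def using p by (intro mult_right_mono) auto
    moreover have "k * p \<le> c5 c * 1" unfolding k_def using p tuning_pos by (intro mult_mono) auto
    ultimately show ?thesis unfolding lam_tilde_def p_def[symmetric] by (intro min.boundedI; linarith)
  qed
  with k show ?thesis using that by blast
qed

lemma sum_w_ge:
  assumes \<eta>: "\<eta> > 0"
  obtains k where "k > 0" "\<And>t. t \<ge> 2 \<Longrightarrow> k * real t powr (1 / 2 - \<eta>) \<le> (\<Sum>i\<in>{1..<t}. w i)"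
proof -
  obtain k where k: "k > 0" "\<And>i. i \<ge> 1 \<Longrightarrow> k * real i powr - (1 / 2 + \<eta>) \<le> w i"
    by (rule w_ge[OF \<eta>]) (rule that)
  have "k / 2 * real t powr (1 / 2 - \<eta>) \<le> (\<Sum>i\<in>{1..<t}. w i)" if t: "t \<ge> 2" for t
  proof -
    have "k / 2 * real t powr (1 / 2 - \<eta>) = (real t / 2) * (k * real t powr - (1 / 2 + \<eta>))"
      using t powr_add[of "real t" 1 "- (1 / 2 + \<eta>)"] by simp
    also have "\<dots> \<le> real (t - 1) * (k * real t powr - (1 / 2 + \<eta>))"
      using t k by (intro mult_right_mono) (auto simp: of_nat_diff)
    also have "\<dots> = (\<Sum>i\<in>{1..<t}. k * real t powr - (1 / 2 + \<eta>))" by simp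
    also have "\<dots> \<le> (\<Sum>i\<in>{1..<t}. w i)"
    proof (rule sum_mono)
      fix i assume i: "i \<in> {1..<t}"
      have "k * real t powr - (1 / 2 + \<eta>) \<le> k * real i powr - (1 / 2 + \<eta>)"
        using i k \<eta> by (intro mult_left_mono powr_mono2') auto
      also have "\<dots> \<le> w i" using i k by auto
      finally show "k * real t powr - (1 / 2 + \<eta>) \<le> w i" .
    qed
    finally show ?thesis .
  qed
  with k show ?thesis using that[of "k / 2"] by simp
qed

lemma sum_w_pos: "t \<ge> 2 \<Longrightarrow> 0 < (\<Sum>i\<in>{1..<t}. w i)"
  by (intro sum_pos) (auto intro: w_pos)

lemma w_le:
  assumes "s > 0"
  obtains K where "K > 0" "\<And>i. i \<ge> 1 \<Longrightarrow> w i \<le> K * real i powr - (1 / 2)"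
proof -
  obtain k where k: "k > 0" "\<And>n. n \<ge> 1 \<Longrightarrow> k \<le> sigma2_hat c x n"
    by (rule pos_seq_bounded_below[OF poly_null_tendsto[OF sigma2_hat_rate] assms])
       (rule sigma2_hat_pos, assumption, rule that)
  define K where "K = sqrt (2 * ln (2 / \<alpha>) / (k * ln 2))"
  have K: "K > 0" using k ln_2_over_\<alpha> by (simp add: K_def)
  have "w i \<le> K * real i powr - (1 / 2)" if i: "i \<ge> 1" for i
  proof -
    have "2 * ln (2 / \<alpha>) / (sigma2_hat c x i * real i * ln (1 + real i)) \<le> 2 * ln (2 / \<alpha>) / (k * real i * ln 2)"
      using i k ln_2_over_\<alpha> sigma2_hat_pos[OF i] by (intro divide_left_mono mult_mono mult_pos_pos) auto
    then have "w i \<le> sqrt (2 * ln (2 / \<alpha>) / (k * real i * ln 2))"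
      unfolding lam_tilde_def by (intro min.coboundedI1 real_sqrt_le_mono)
    also have "\<dots> = sqrt (2 * ln (2 / \<alpha>) / (k * ln 2) / real i)" by (simp add: mult_ac)
    also have "\<dots> = K / sqrt (real i)" by (simp only: K_def real_sqrt_divide)
    also have "\<dots> = K * real i powr - (1 / 2)" by (simp add: powr_minus powr_half_sqrt inverse_eq_divide)
    finally show ?thesis .
  qed
  with K show ?thesis using that by blast
qed

text \<open>As the weights are nonincreasing, summation by parts transfers the rate of the plain
  average to the weighted one: up to a constant, the sum of \<open>x i - \<mu>\<close> over \<open>i \<le> j\<close> is at most
  \<open>j powr (1 - e)\<close>, hence at most the sum of \<open>i powr - e\<close> over \<open>i \<le> j\<close>. With weights of order \<open>i powr - (1/2)\<close> up to logarithms, half of the exponent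
  \<open>e\<close> survives.\<close>
lemma mu_hat_B_rate_nondegenerate:
  assumes s: "s > 0"
  shows "poly_null (\<lambda>t. mu_hat Form_B c \<alpha> x t - \<mu>)"
proof -
  have q: "(0::real) < 1 / 4" by simp
  obtain e K where e: "0 < e" "e \<le> 1 / 4" "K > 0"
    and K: "\<And>n. n \<ge> 1 \<Longrightarrow> \<bar>(\<Sum>i\<in>{1..<n}. x i - \<mu>) / real n\<bar> \<le> K * real n powr - e"
    by (rule poly_nullE[OF mean1 q]) (rule that)
  have e2: "e / 2 > 0" using e by simp
  obtain k where k: "k > 0" and sum_ge: "\<And>t. t \<ge> 2 \<Longrightarrow> k * real t powr (1 / 2 - e / 2) \<le> (\<Sum>i\<in>{1..<t}. w i)"
    by (rule sum_w_ge[OF e2]) (rule that)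
  obtain Kw where Kw: "Kw > 0" "\<And>i. i \<ge> 1 \<Longrightarrow> w i \<le> Kw * real i powr - (1 / 2)"
    by (rule w_le[OF s]) (rule that)
  have partial: "\<bar>\<Sum>i\<in>{1..j}. x i - \<mu>\<bar> \<le> (\<Sum>i\<in>{1..j}. 2 * K * real i powr - e)" if j: "1 \<le> j" for j
  proof -
    have iv: "{1..<Suc j} = {1..j}" by auto
    have "\<bar>\<Sum>i\<in>{1..j}. x i - \<mu>\<bar> / real (Suc j) \<le> K * real (Suc j) powr - e"
      using K[of "Suc j"] unfolding iv by (simp add: abs_divide)
    then have "\<bar>\<Sum>i\<in>{1..j}. x i - \<mu>\<bar> \<le> K * real (Suc j) powr - e * real (Suc j)"
      by (simp add: pos_divide_le_eq)
    also have "\<dots> \<le> K * real j powr - e * (2 * real j)"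
      using j e by (intro mult_mono mult_left_mono powr_mono2') auto
    also have "\<dots> = (\<Sum>i\<in>{1..j}. 2 * K * real j powr - e)" by simp
    also have "\<dots> \<le> (\<Sum>i\<in>{1..j}. 2 * K * real i powr - e)"
      using e by (intro sum_mono mult_left_mono powr_mono2') auto
    finally show ?thesis .
  qed
  define C where "C = 2 * K * Kw / (1 / 2 - e)"
  show ?thesis
  proof (rule poly_nullI_eventually[OF e2])
    show "eventually (\<lambda>t. \<bar>mu_hat Form_B c \<alpha> x t - \<mu>\<bar> \<le> (C / k) * real t powr - (e / 2)) sequentially"
      using eventually_ge_at_top[of 2]
    proof eventually_elim
      case (elim t)
      define H where "H = (\<Sum>i\<in>{1..<t}. w i)"
      have H: "H > 0" using sum_w_pos elim by (simp add: H_def)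
      have iv: "{1..<t} = {1..t - 1}" using elim by auto
      have "\<bar>\<Sum>i\<in>{1..<t}. w i * (x i - \<mu>)\<bar> \<le> (\<Sum>i\<in>{1..<t}. w i * (2 * K * real i powr - e))"
        unfolding iv
        by (rule abs_sum_mult_antimono_le) (use partial w_antimono w_pos elim in \<open>auto intro: less_imp_le\<close>)
      also have "\<dots> \<le> (\<Sum>i\<in>{1..<t}. 2 * K * Kw * real i powr - (1 / 2 + e))"
      proof (rule sum_mono)
        fix i assume i: "i \<in> {1..<t}"
        have "w i * (2 * K * real i powr - e) \<le> Kw * real i powr - (1 / 2) * (2 * K * real i powr - e)"
          using i Kw e by (intro mult_right_mono) auto
        also have "\<dots> = 2 * K * Kw * (real i powr - (1 / 2) * real i powr - e)" by simp
        also have "real i powr - (1 / 2) * real i powr - e = real i powr - (1 / 2 + e)"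
          by (simp flip: powr_add)
        finally show "w i * (2 * K * real i powr - e) \<le> 2 * K * Kw * real i powr - (1 / 2 + e)" .
      qed
      also have "\<dots> = 2 * K * Kw * (\<Sum>i\<in>{1..<t}. real i powr - (1 / 2 + e))" by (rule sum_distrib_left[symmetric])
      also have "\<dots> \<le> 2 * K * Kw * (real t powr (1 - (1 / 2 + e)) / (1 - (1 / 2 + e)))"
        using e Kw by (intro mult_left_mono sum_lessThan_powr_neg_le) auto
      also have "\<dots> = C * real t powr (1 / 2 - e)" by (simp add: C_def)
      finally have num: "\<bar>\<Sum>i\<in>{1..<t}. w i * (x i - \<mu>)\<bar> \<le> C * real t powr (1 / 2 - e)" .
      have "mu_hat Form_B c \<alpha> x t - \<mu> = (\<Sum>i\<in>{1..<t}. w i * x i) / H - \<mu>" using elim by (simp add: H_def)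
      also have "\<dots> = (\<Sum>i\<in>{1..<t}. w i * (x i - \<mu>)) / H"
        using H by (simp add: H_def right_diff_distrib sum_subtractf sum_distrib_right[symmetric] diff_divide_distrib)
      finally have "\<bar>mu_hat Form_B c \<alpha> x t - \<mu>\<bar> = \<bar>\<Sum>i\<in>{1..<t}. w i * (x i - \<mu>)\<bar> / H" using H by (simp add: abs_divide)
      also have "\<dots> \<le> C * real t powr (1 / 2 - e) / (k * real t powr (1 / 2 - e / 2))"
        using num sum_ge[of t] elim k unfolding H_def by (intro frac_le) auto
      also have "\<dots> = (C / k) * (real t powr (1 / 2 - e) / real t powr (1 / 2 - e / 2))" by simp
      also have "real t powr (1 / 2 - e) / real t powr (1 / 2 - e / 2) = real t powr - (e / 2)"
        unfolding powr_diff[symmetric] by (simp add: field_simps)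
      finally show ?case .
    qed
  qed
qed

lemma mu_hat_B_degenerate:
  assumes "s = 0" "t \<ge> 2"
  shows "mu_hat Form_B c \<alpha> x t = \<mu>"
proof -
  have "(\<Sum>i\<in>{1..<t}. w i * x i) = (\<Sum>i\<in>{1..<t}. w i * \<mu>)"
    using degenerate[OF assms(1)] by (intro sum.cong) auto
  also have "\<dots> = (\<Sum>i\<in>{1..<t}. w i) * \<mu>" by (simp add: sum_distrib_right)
  finally show ?thesis using assms sum_w_pos[of t] by simp
qed

lemma mu_hat_rate: "poly_null (\<lambda>t. mu_hat f c \<alpha> x t - \<mu>)"
proof (cases f)
  case Form_A then show ?thesis using mu_bar_rate by simp
next
  case Form_B
  show ?thesis
  proof (cases "s = 0")
    case True
    have "eventually (\<lambda>t. \<bar>mu_hat f c \<alpha> x t - \<mu>\<bar> \<le> 0 * real t powr - 1) sequentially"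
      using eventually_ge_at_top[of 2]
      by eventually_elim (use Form_B mu_hat_B_degenerate[OF True] in simp)
    then show ?thesis by (rule poly_nullI_eventually[rotated]) simp
  next
    case False
    then show ?thesis using mu_hat_B_rate_nondegenerate s_nonneg Form_B by simp
  qed
qed

definition Z :: "nat \<Rightarrow> real" where
  "Z i = ((x i - mu_hat f c \<alpha> x i)\<^sup>2 - sigma2_hat c x i)\<^sup>2"

lemma m4sq_hat_eq: "m4sq_hat f c \<alpha> x t = (c2 c + (\<Sum>i\<in>{1..<t}. Z i)) / real t"
  by (simp add: m4sq_hat_def Z_def)

lemma residual_rate: "poly_null (\<lambda>i. (x i - mu_hat f c \<alpha> x i)\<^sup>2 - (x i - \<mu>)\<^sup>2)"
proof -
  have "poly_null (\<lambda>i. - 1 * (mu_hat f c \<alpha> x i - \<mu>))" by (rule poly_null_cmult[OF mu_hat_rate])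
  then have "poly_null (\<lambda>i. (x i - mu_hat f c \<alpha> x i) - (x i - \<mu>))" by (rule poly_null_cong) simp
  then show ?thesis by (rule poly_null_power2_diff[OF _ dev_bound])
qed

lemma dev_power2_bound: "i \<ge> 1 \<Longrightarrow> (x i - \<mu>)\<^sup>2 \<le> (1 + \<bar>\<mu>\<bar>)\<^sup>2"
  using dev_bound[of i] by (metis abs_ge_zero abs_le_square_iff abs_of_nonneg order_trans)

lemma Z_rate: "poly_null (\<lambda>i. Z i - ((x i - \<mu>)\<^sup>2 - s)\<^sup>2)"
  unfolding Z_def
proof (rule poly_null_power2_diff)
  show "poly_null (\<lambda>i. (x i - mu_hat f c \<alpha> x i)\<^sup>2 - sigma2_hat c x i - ((x i - \<mu>)\<^sup>2 - s))"
    using poly_null_diff[OF residual_rate sigma2_hat_rate] by (rule poly_null_cong) simp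
  show "\<bar>(x i - \<mu>)\<^sup>2 - s\<bar> \<le> (1 + \<bar>\<mu>\<bar>)\<^sup>2 + s" if "i \<ge> 1" for i
    using dev_power2_bound[OF that] s_nonneg zero_le_power2[of "x i - \<mu>"] by linarith
qed

lemma Z_bounded:
  obtains B where "\<And>i. i \<ge> 1 \<Longrightarrow> Z i \<le> B"
proof -
  obtain B where B: "\<And>i. i \<ge> 1 \<Longrightarrow> \<bar>Z i - ((x i - \<mu>)\<^sup>2 - s)\<^sup>2\<bar> \<le> B"
    by (rule poly_null_bounded[OF Z_rate]) (rule that)
  have "Z i \<le> B + ((1 + \<bar>\<mu>\<bar>)\<^sup>2 + s)\<^sup>2" if i: "i \<ge> 1" for i
  proof -
    have "((x i - \<mu>)\<^sup>2 - s)\<^sup>2 \<le> ((1 + \<bar>\<mu>\<bar>)\<^sup>2 + s)\<^sup>2"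
      using dev_power2_bound[OF i] s_nonneg zero_le_power2[of "x i - \<mu>"]
      by (subst abs_le_square_iff[symmetric]) linarith
    then show ?thesis using B[OF i] by linarith
  qed
  then show ?thesis by (rule that)
qed

lemma m4sq_hat_rate: "poly_null (\<lambda>t. m4sq_hat f c \<alpha> x t - v)"
  unfolding m4sq_hat_eq by (rule poly_null_mean_perturb[OF mean4 Z_rate])

lemma residual_bounded:
  obtains B where "\<And>i. i \<ge> 1 \<Longrightarrow> (x i - mu_hat f c \<alpha> x i)\<^sup>2 \<le> B"
proof -
  obtain B where B: "\<And>i. i \<ge> 1 \<Longrightarrow> \<bar>(x i - mu_hat f c \<alpha> x i)\<^sup>2 - (x i - \<mu>)\<^sup>2\<bar> \<le> B"
    by (rule poly_null_bounded[OF residual_rate]) (rule that)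
  have "(x i - mu_hat f c \<alpha> x i)\<^sup>2 \<le> B + (1 + \<bar>\<mu>\<bar>)\<^sup>2" if i: "i \<ge> 1" for i
    using B[OF i] dev_power2_bound[OF i] by linarith
  then show ?thesis by (rule that)
qed

text \<open>With \<open>x i = \<mu>\<close> the fourth-moment average in \<open>mean4\<close> is that of the constant \<open>- v\<close>, and it tends
  to \<open>0\<close>.\<close>
lemma v_eq_0_if_degenerate:
  assumes "s = 0"
  shows "v = 0"
proof -
  have "poly_null (\<lambda>n. (\<Sum>i\<in>{1..<n}. 0 - v) / real n)"
    using mean4 by (rule poly_null_cong) (use degenerate[OF assms] assms in \<open>auto intro!: arg_cong2[where f = "(/)"] sum.cong\<close>)
  from poly_null_mean_perturb[OF this, of "\<lambda>_. 0" 0]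
  have "poly_null (\<lambda>n. 0 - v)" by (simp add: poly_null_zero)
  then have "(\<lambda>n. 0) \<longlonglongrightarrow> v" by (rule poly_null_tendsto)
  then show ?thesis using LIMSEQ_unique tendsto_const by blast
qed

lemma residual_le_degenerate:
  assumes "s = 0" "i \<ge> 1"
  shows "(x i - mu_hat f c \<alpha> x i)\<^sup>2 \<le> ((\<mu> - c4 c)\<^sup>2 + (\<mu> - 1 / 2)\<^sup>2) / real i"
proof (cases f)
  case Form_A
  have "(\<Sum>j\<in>{1..<i}. x j) = (\<Sum>j\<in>{1..<i}. \<mu>)"
    using degenerate[OF assms(1)] by (intro sum.cong) auto
  then have "mu_bar c x i = (c4 c + (real i - 1) * \<mu>) / real i" using assms by (simp add: mu_bar_def of_nat_diff)
  then have "x i - mu_bar c x i = (\<mu> - c4 c) / real i"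
    using assms degenerate[OF assms] by (simp add: field_simps)
  then have "(x i - mu_hat f c \<alpha> x i)\<^sup>2 = (\<mu> - c4 c)\<^sup>2 / (real i)\<^sup>2" using Form_A by (simp add: power_divide)
  also have "\<dots> \<le> (\<mu> - c4 c)\<^sup>2 / real i"
    using assms by (intro divide_left_mono) (auto simp: power2_eq_square)
  also have "\<dots> \<le> ((\<mu> - c4 c)\<^sup>2 + (\<mu> - 1 / 2)\<^sup>2) / real i" by (intro divide_right_mono) auto
  finally show ?thesis .
next
  case Form_B
  show ?thesis
  proof (cases "i = 1")
    case True then show ?thesis using Form_B degenerate[OF assms] by simp
  next
    case False
    then have "x i - mu_hat f c \<alpha> x i = 0"
      using Form_B assms mu_hat_B_degenerate[of i] degenerate[OF assms] by simp
    then show ?thesis by simp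
  qed
qed

end

section \<open>The error split\<close>

lemma alpha1_bounds:
  assumes "0 < \<alpha>" "\<alpha> < 1"
  shows "n \<ge> 3 \<Longrightarrow> 0 \<le> ln (2 / alpha1 \<alpha> n)"
    and "\<eta> > 0 \<Longrightarrow> \<exists>K>0. \<forall>n\<ge>3. ln (2 / alpha1 \<alpha> n) \<le> K * real n powr \<eta>"
proof -
  have ln1: "1 \<le> ln (real n)" if "n \<ge> 3" for n :: nat
  proof -
    have "exp 1 \<le> real n" using exp_le that by (intro order_trans[OF exp_le]) auto
    then show ?thesis using that by (subst ln_ge_iff) auto
  qed
  have eq: "2 / alpha1 \<alpha> n = 2 * ln (real n) / \<alpha>" for n by (simp add: alpha1_def)
  have ge1: "1 \<le> 2 / alpha1 \<alpha> n" if "n \<ge> 3" for n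
    unfolding eq using ln1[OF that] assms by (simp add: le_divide_eq)
  show "n \<ge> 3 \<Longrightarrow> 0 \<le> ln (2 / alpha1 \<alpha> n)" using ge1 by (intro ln_ge_zero)
  show "\<exists>K>0. \<forall>n\<ge>3. ln (2 / alpha1 \<alpha> n) \<le> K * real n powr \<eta>" if \<eta>: "\<eta> > 0"
  proof (intro exI conjI allI impI)
    show "2 / \<alpha> / \<eta> > 0" using \<eta> assms by simp
    fix n :: nat assume n: "n \<ge> 3"
    have "ln (2 / alpha1 \<alpha> n) \<le> 2 / alpha1 \<alpha> n - 1" by (rule ln_le_minus_one[OF less_le_trans[OF zero_less_one ge1[OF n]]])
    also have "\<dots> \<le> 2 / \<alpha> * ln (real n)" by (simp add: eq)
    also have "\<dots> \<le> 2 / \<alpha> * (real n powr \<eta> / \<eta>)"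
      using assms n \<eta> by (intro mult_left_mono ln_powr_bound) auto
    finally show "ln (2 / alpha1 \<alpha> n) \<le> 2 / \<alpha> / \<eta> * real n powr \<eta>" by simp
  qed
qed

lemma alpha2_tendsto: "alpha2 \<alpha> \<longlonglongrightarrow> \<alpha>"
proof -
  have "(\<lambda>n. (1 - inverse (ln (real n))) * \<alpha>) \<longlonglongrightarrow> (1 - 0) * \<alpha>"
    by (intro tendsto_intros tendsto_inverse_0_at_top filterlim_compose[OF ln_at_top filterlim_real_sequentially])
  then have "(\<lambda>n. (1 - inverse (ln (real n))) * \<alpha>) \<longlonglongrightarrow> \<alpha>" by simp
  moreover have "eventually (\<lambda>n. (1 - inverse (ln (real n))) * \<alpha> = alpha2 \<alpha> n) sequentially"
    using eventually_ge_at_top[of 2]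
  proof eventually_elim
    case (elim n)
    then have "ln (real n) > 0" by (intro ln_gt_zero) auto
    then show ?case by (simp add: alpha2_def diff_divide_distrib inverse_eq_divide)
  qed
  ultimately show ?thesis by (rule Lim_transform_eventually)
qed

section \<open>The correction terms of the lower limit\<close>

context regular_path
begin

lemma plug_in_weights_lam:
  assumes "\<delta> \<longlonglongrightarrow> \<alpha>"
  obtains B where "plug_in_weights Z (m4sq_hat f c \<alpha> x) (\<lambda>n. ln (1 / \<delta> n)) (c2 c) (c1 c) B v (ln (1 / \<alpha>))
     (\<lambda>n. lam f c \<alpha> x n (\<delta> n))"
proof -
  obtain B where B: "\<And>i. i \<ge> 1 \<Longrightarrow> Z i \<le> B" by (rule Z_bounded) (rule that)
  have "plug_in_weights Z (m4sq_hat f c \<alpha> x) (\<lambda>n. ln (1 / \<delta> n)) (c2 c) (c1 c) B v (ln (1 / \<alpha>))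
     (\<lambda>n. lam f c \<alpha> x n (\<delta> n))"
  proof
    show "0 \<le> Z i" for i by (simp add: Z_def)
    show "Z i \<le> B" if "i \<ge> 1" for i by (rule B[OF that])
    show "0 < c2 c" "0 < c1 c" "c1 c < 1" using tuning_pos by auto
    show "m4sq_hat f c \<alpha> x i = (c2 c + (\<Sum>j\<in>{1..<i}. Z j)) / real i" for i by (rule m4sq_hat_eq)
    show "poly_null (\<lambda>i. m4sq_hat f c \<alpha> x i - v)" by (rule m4sq_hat_rate)
    show "(\<lambda>n. ln (1 / \<delta> n)) \<longlonglongrightarrow> ln (1 / \<alpha>)"
      using assms \<alpha> by (intro tendsto_ln tendsto_divide tendsto_const) auto
    show "0 < ln (1 / \<alpha>)" using \<alpha> by (intro ln_gt_zero) (simp add: field_simps)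
    show "lam f c \<alpha> x n (\<delta> n) i = min (sqrt (2 * ln (1 / \<delta> n) / (m4sq_hat f c \<alpha> x i * real n))) (c1 c)" for n i
      by (simp add: lam_def)
  qed
  then show ?thesis by (rule that)
qed

lemma radius_tendsto:
  assumes "\<delta> \<longlonglongrightarrow> \<alpha>"
  shows "(\<lambda>n. sqrt (real n) * radius f c \<alpha> x n (\<delta> n)) \<longlonglongrightarrow> sqrt (2 * v * ln (1 / \<alpha>))"
proof -
  obtain B where "plug_in_weights Z (m4sq_hat f c \<alpha> x) (\<lambda>n. ln (1 / \<delta> n)) (c2 c) (c1 c) B v (ln (1 / \<alpha>))
     (\<lambda>n. lam f c \<alpha> x n (\<delta> n))"
    by (rule plug_in_weights_lam[OF assms]) (rule that)
  then interpret plug_in_weights Z "m4sq_hat f c \<alpha> x" "\<lambda>n. ln (1 / \<delta> n)" "c2 c" "c1 c" B v "ln (1 / \<alpha>)"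
     "\<lambda>n. lam f c \<alpha> x n (\<delta> n)" .
  have "rad = (\<lambda>n. radius f c \<alpha> x n (\<delta> n))"
    by (rule ext) (simp add: rad_def radius_def Z_def)
  then show ?thesis using rad_tendsto by simp
qed

lemma wavg_lam_tendsto_0:
  assumes "\<delta> \<longlonglongrightarrow> \<alpha>"
    and "\<And>\<eta>. \<eta> > 0 \<Longrightarrow> \<exists>K. eventually (\<lambda>n. \<forall>i\<in>{1..n}. 0 \<le> t n i \<and>
      t n i \<le> K * real n powr \<eta> / real i) sequentially"
  shows "(\<lambda>n. sqrt (real n) * wavg (lam f c \<alpha> x n (\<delta> n)) (t n) n) \<longlonglongrightarrow> 0"
proof -
  obtain B where "plug_in_weights Z (m4sq_hat f c \<alpha> x) (\<lambda>n. ln (1 / \<delta> n)) (c2 c) (c1 c) B v (ln (1 / \<alpha>))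
     (\<lambda>n. lam f c \<alpha> x n (\<delta> n))"
    by (rule plug_in_weights_lam[OF assms(1)]) (rule that)
  then interpret plug_in_weights Z "m4sq_hat f c \<alpha> x" "\<lambda>n. ln (1 / \<delta> n)" "c2 c" "c1 c" B v "ln (1 / \<alpha>)"
     "\<lambda>n. lam f c \<alpha> x n (\<delta> n)" .
  show ?thesis by (rule sqrt_wavg_tendsto_0[OF assms(2)])
qed

lemma lam_pos:
  assumes "\<delta> \<longlonglongrightarrow> \<alpha>"
  shows "eventually (\<lambda>n. \<forall>i\<in>{1..n}. 0 < lam f c \<alpha> x n (\<delta> n) i) sequentially"
proof -
  obtain B where "plug_in_weights Z (m4sq_hat f c \<alpha> x) (\<lambda>n. ln (1 / \<delta> n)) (c2 c) (c1 c) B v (ln (1 / \<alpha>))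
     (\<lambda>n. lam f c \<alpha> x n (\<delta> n))"
    by (rule plug_in_weights_lam[OF assms(1)]) (rule that)
  then interpret plug_in_weights Z "m4sq_hat f c \<alpha> x" "\<lambda>n. ln (1 / \<delta> n)" "c2 c" "c1 c" B v "ln (1 / \<alpha>)"
     "\<lambda>n. lam f c \<alpha> x n (\<delta> n)" .
  obtain k K where "k > 0" "K > 0"
    and W: "eventually (\<lambda>n. \<forall>i\<in>{1..n}. k / sqrt (m4sq_hat f c \<alpha> x i) \<le> sqrt (real n) * lam f c \<alpha> x n (\<delta> n) i \<and>
       sqrt (real n) * lam f c \<alpha> x n (\<delta> n) i \<le> K / sqrt (m4sq_hat f c \<alpha> x i) \<and> 0 < lam f c \<alpha> x n (\<delta> n) i) sequentially"
    by (rule weights_bounds) (rule that)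
  from W show ?thesis by eventually_elim blast
qed

text \<open>The factor \<open>ln (2 / \<alpha>\<^sub>1)\<close> grows like \<open>ln (ln n)\<close> and the sum of the \<open>\<lambda>\<close>-tilde up to \<open>i\<close> is of order
  \<open>sqrt i\<close> up to logarithms; all logarithms are absorbed into \<open>n powr \<eta>\<close>.\<close>
lemma C0_tilde_bound:
  assumes "\<eta> > 0"
  shows "\<exists>K. eventually (\<lambda>n. \<forall>i\<in>{1..n}. 0 \<le> C0_tilde c \<alpha> x (alpha1 \<alpha> n) i \<and>
      C0_tilde c \<alpha> x (alpha1 \<alpha> n) i \<le> K * real n powr \<eta> / real i) sequentially"
proof -
  define h where "h = \<eta> / 4"
  have h: "h > 0" using assms by (simp add: h_def)
  obtain k where k: "k > 0" "\<And>t. t \<ge> 2 \<Longrightarrow> k * real t powr (1 / 2 - h) \<le> (\<Sum>i\<in>{1..<t}. w i)"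
    by (rule sum_w_ge[OF h]) (rule that)
  obtain A where A: "A > 0" "\<And>n. n \<ge> 3 \<Longrightarrow> ln (2 / alpha1 \<alpha> n) \<le> A * real n powr h"
    using alpha1_bounds(2)[OF \<alpha> h] by blast
  define K where "K = 1 / 4 + (A / k)\<^sup>2"
  have "eventually (\<lambda>n. \<forall>i\<in>{1..n}. 0 \<le> C0_tilde c \<alpha> x (alpha1 \<alpha> n) i \<and>
      C0_tilde c \<alpha> x (alpha1 \<alpha> n) i \<le> K * real n powr \<eta> / real i) sequentially"
    using eventually_ge_at_top[of 3]
  proof eventually_elim
    case (elim n)
    show ?case
    proof (intro ballI conjI)
      fix i assume i: "i \<in> {1..n}"
      show "0 \<le> C0_tilde c \<alpha> x (alpha1 \<alpha> n) i" by (simp add: C0_tilde_def)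
      have n1: "1 \<le> real n powr \<eta>" using elim assms by (intro ge_one_powr_ge_zero) auto
      show "C0_tilde c \<alpha> x (alpha1 \<alpha> n) i \<le> K * real n powr \<eta> / real i"
      proof (cases "i = 1")
        case True
        have "1 / 4 * 1 \<le> K * real n powr \<eta>" using n1 unfolding K_def by (intro mult_mono) auto
        then show ?thesis using True by (simp add: C0_tilde_def)
      next
        case False
        then have i2: "i \<ge> 2" using i by simp
        have "(ln (2 / alpha1 \<alpha> n))\<^sup>2 / (\<Sum>j\<in>{1..<i}. w j)\<^sup>2
            \<le> (A * real n powr h)\<^sup>2 / (k * real i powr (1 / 2 - h))\<^sup>2"
          using A(2)[OF elim] alpha1_bounds(1)[OF \<alpha> elim] k i2
          by (intro frac_le power_mono) auto
        also have "\<dots> = (A / k)\<^sup>2 * (real n powr (2 * h) / real i powr (1 - 2 * h))"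
        proof -
          have "(real n powr h)\<^sup>2 = real n powr (2 * h)" by (simp add: power2_eq_square flip: powr_add)
          moreover have "(real i powr (1 / 2 - h))\<^sup>2 = real i powr (1 - 2 * h)"
            by (simp add: power2_eq_square flip: powr_add)
          ultimately show ?thesis by (simp add: power_mult_distrib power_divide)
        qed
        also have "real n powr (2 * h) / real i powr (1 - 2 * h) = real n powr (2 * h) * real i powr (2 * h) / real i"
          using i by (simp add: powr_diff)
        also have "\<dots> \<le> real n powr (2 * h) * real n powr (2 * h) / real i"
          using i h by (intro divide_right_mono mult_left_mono powr_mono2) auto
        also have "real n powr (2 * h) * real n powr (2 * h) = real n powr \<eta>"
          by (simp add: h_def flip: powr_add)
        also have "(A / k)\<^sup>2 * (real n powr \<eta> / real i) \<le> K * (real n powr \<eta> / real i)"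
          unfolding K_def by (intro mult_right_mono) auto
        finally show ?thesis using i2 by (simp add: C0_tilde_def mult_left_mono)
      qed
    qed
  qed
  then show ?thesis by blast
qed

lemma sum_psiP_w_nonneg: "0 \<le> (\<Sum>i\<in>{1..<t}. psiP (w i))"
proof (rule sum_nonneg)
  fix i assume "i \<in> {1..<t}"
  then show "0 \<le> psiP (w i)" using psiP_pos[OF w_pos[of i]] by simp
qed

lemma sum_psiP_w_le:
  assumes "s > 0" "\<eta> > 0" "\<eta> < 1"
  obtains K where "K > 0" "\<And>t. (\<Sum>i\<in>{1..<t}. psiP (w i)) \<le> K * real t powr \<eta>"
proof -
  obtain Kw where Kw: "Kw > 0" "\<And>i. i \<ge> 1 \<Longrightarrow> w i \<le> Kw * real i powr - (1 / 2)"
    by (rule w_le[OF assms(1)]) (rule that)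
  define K where "K = exp (c5 c) * Kw\<^sup>2 / \<eta>"
  have "(\<Sum>i\<in>{1..<t}. psiP (w i)) \<le> K * real t powr \<eta>" for t
  proof -
    have "(\<Sum>i\<in>{1..<t}. psiP (w i)) \<le> (\<Sum>i\<in>{1..<t}. exp (c5 c) * Kw\<^sup>2 * real i powr - (1 - \<eta>))"
    proof (rule sum_mono)
      fix i assume i: "i \<in> {1..<t}"
      have wi: "0 < w i" using i w_pos by simp
      have "(w i)\<^sup>2 \<le> (Kw * real i powr - (1 / 2))\<^sup>2" using wi Kw i by (intro power_mono) auto
      also have "\<dots> = Kw\<^sup>2 * real i powr - 1"
      proof -
        have "(real i powr - (1 / 2))\<^sup>2 = real i powr - 1"
          by (simp add: power2_eq_square flip: powr_add)
        then show ?thesis by (simp only: power_mult_distrib)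
      qed
      also have "\<dots> \<le> Kw\<^sup>2 * real i powr - (1 - \<eta>)"
        using i assms by (intro mult_left_mono powr_mono) auto
      finally have w2: "(w i)\<^sup>2 \<le> Kw\<^sup>2 * real i powr - (1 - \<eta>)" .
      have "psiP (w i) \<le> exp (w i) * (w i)\<^sup>2" using wi by (intro psiP_le) auto
      also have "\<dots> \<le> exp (c5 c) * (Kw\<^sup>2 * real i powr - (1 - \<eta>))"
        using w2 w_le_c5 by (intro mult_mono) auto
      finally show "psiP (w i) \<le> exp (c5 c) * Kw\<^sup>2 * real i powr - (1 - \<eta>)" by simp
    qed
    also have "\<dots> = exp (c5 c) * Kw\<^sup>2 * (\<Sum>i\<in>{1..<t}. real i powr - (1 - \<eta>))" by (rule sum_distrib_left[symmetric])
    also have "\<dots> \<le> exp (c5 c) * Kw\<^sup>2 * (real t powr (1 - (1 - \<eta>)) / (1 - (1 - \<eta>)))"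
      using assms by (intro mult_left_mono sum_lessThan_powr_neg_le) auto
    also have "\<dots> = K * real t powr \<eta>" by (simp add: K_def)
    finally show ?thesis .
  qed
  moreover have "K > 0" using Kw assms by (simp add: K_def)
  ultimately show ?thesis using that by blast
qed

lemma C12_tilde_nonneg:
  "0 \<le> C2_tilde c \<alpha> x i" "n \<ge> 3 \<Longrightarrow> 0 \<le> C1_tilde c \<alpha> x (alpha1 \<alpha> n) i"
  using alpha1_bounds(1)[OF \<alpha>, of n] sum_psiP_w_nonneg[of i]
  by (auto simp: C2_tilde_def C1_tilde_def)

lemma C2_tilde_pos: "i \<ge> 2 \<Longrightarrow> 0 < C2_tilde c \<alpha> x i"
  using sum_w_pos[of i] sum_pos[of "{1..<i}" "\<lambda>j. psiP (w j)"] psiP_pos[OF w_pos]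
  by (simp add: C2_tilde_def)

text \<open>On \<open>[0, c\<^sub>5]\<close> the function \<open>psiP\<close> is at most linear. This crude bound serves the case \<open>s = 0\<close>, in
  which \<open>C2_tilde\<close> decays only logarithmically.\<close>
lemma C2_tilde_le: "C2_tilde c \<alpha> x i \<le> (exp (c5 c) * c5 c)\<^sup>2"
proof (cases "i = 1 \<or> i = 0")
  case True then show ?thesis by (auto simp: C2_tilde_def)
next
  case False
  then have i: "i \<ge> 2" by simp
  have "(\<Sum>j\<in>{1..<i}. psiP (w j)) \<le> (\<Sum>j\<in>{1..<i}. exp (c5 c) * c5 c * w j)"
  proof (rule sum_mono)
    fix j assume "j \<in> {1..<i}"
    then have wj: "0 < w j" using w_pos by simp
    have "psiP (w j) \<le> exp (w j) * (w j)\<^sup>2" using wj by (intro psiP_le) auto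
    also have "\<dots> \<le> exp (c5 c) * (c5 c * w j)"
      using wj w_le_c5[of j] unfolding power2_eq_square by (intro mult_mono) auto
    finally show "psiP (w j) \<le> exp (c5 c) * c5 c * w j" by simp
  qed
  also have "\<dots> = exp (c5 c) * c5 c * (\<Sum>j\<in>{1..<i}. w j)" by (rule sum_distrib_left[symmetric])
  finally have "(\<Sum>j\<in>{1..<i}. psiP (w j)) / (\<Sum>j\<in>{1..<i}. w j) \<le> exp (c5 c) * c5 c"
    using sum_w_pos[OF i] by (simp add: pos_divide_le_eq)
  then have "((\<Sum>j\<in>{1..<i}. psiP (w j)) / (\<Sum>j\<in>{1..<i}. w j))\<^sup>2 \<le> (exp (c5 c) * c5 c)\<^sup>2"
    using sum_psiP_w_nonneg sum_w_pos[OF i] by (intro power_mono divide_nonneg_pos)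
  then show ?thesis using i by (simp add: C2_tilde_def power_divide)
qed

text \<open>For \<open>s > 0\<close> the squares of the \<open>\<lambda>\<close>-tilde are of order \<open>1 / i\<close>, so that \<open>psiP\<close> of them has almost
  bounded sums.\<close>
lemma C12_tilde_bound:
  assumes s: "s > 0" and "\<eta> > 0"
  shows "\<exists>K. eventually (\<lambda>n. \<forall>i\<in>{1..n}. 0 \<le> C1_tilde c \<alpha> x (alpha1 \<alpha> n) i \<and>
      C1_tilde c \<alpha> x (alpha1 \<alpha> n) i \<le> K * real n powr \<eta> / real i) sequentially" (is ?C1)
    and "\<exists>K. eventually (\<lambda>n. \<forall>i\<in>{1..n}. 0 \<le> C2_tilde c \<alpha> x i \<and>
      C2_tilde c \<alpha> x i \<le> K * real n powr \<eta> / real i) sequentially" (is ?C2)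
proof -
  define h where "h = min \<eta> 1 / 4"
  have h: "h > 0" "h < 1" "4 * h \<le> \<eta>" using assms by (auto simp: h_def)
  obtain k where k: "k > 0" "\<And>t. t \<ge> 2 \<Longrightarrow> k * real t powr (1 / 2 - h) \<le> (\<Sum>i\<in>{1..<t}. w i)"
    by (rule sum_w_ge[OF h(1)]) (rule that)
  obtain A where A: "A > 0" "\<And>n. n \<ge> 3 \<Longrightarrow> ln (2 / alpha1 \<alpha> n) \<le> A * real n powr h"
    using alpha1_bounds(2)[OF \<alpha> h(1)] by blast
  obtain P where P: "P > 0" "\<And>t. (\<Sum>i\<in>{1..<t}. psiP (w i)) \<le> P * real t powr h"
    by (rule sum_psiP_w_le[OF s h(1,2)]) (rule that)
  have key: "a * b / (\<Sum>j\<in>{1..<i}. w j)\<^sup>2 \<le> (a' * P / k\<^sup>2) * real n powr \<eta> / real i"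
    if i: "2 \<le> i" "i \<le> n" and a: "0 \<le> a" "a \<le> a' * real n powr h"
      and b: "0 \<le> b" "b \<le> P * real i powr h" and a': "0 \<le> a'" for a b a' i n
  proof -
    have "a * b / (\<Sum>j\<in>{1..<i}. w j)\<^sup>2 \<le> (a' * real n powr h) * (P * real n powr h) / (k * real i powr (1 / 2 - h))\<^sup>2"
    proof (intro frac_le mult_mono a power_mono)
      have "P * real i powr h \<le> P * real n powr h" using i P h by (intro mult_left_mono powr_mono2) auto
      then show "b \<le> P * real n powr h" using b by linarith
      show "k * real i powr (1 / 2 - h) \<le> (\<Sum>j\<in>{1..<i}. w j)" by (rule k(2)[OF i(1)])
    qed (use a b a' k i P in auto)
    also have "\<dots> = (a' * P / k\<^sup>2) * (real n powr (2 * h) / real i powr (1 - 2 * h))"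
    proof -
      have "real n powr h * real n powr h = real n powr (2 * h)" by (simp flip: powr_add)
      moreover have "(real i powr (1 / 2 - h))\<^sup>2 = real i powr (1 - 2 * h)"
        by (simp add: power2_eq_square flip: powr_add)
      ultimately show ?thesis by (simp add: power_mult_distrib mult_ac)
    qed
    also have "real n powr (2 * h) / real i powr (1 - 2 * h) = real n powr (2 * h) * real i powr (2 * h) / real i"
      using i by (simp add: powr_diff)
    also have "(a' * P / k\<^sup>2) * \<dots> \<le> (a' * P / k\<^sup>2) * (real n powr (2 * h) * real n powr (2 * h) / real i)"
      using i h a' P by (intro mult_left_mono divide_right_mono powr_mono2) auto
    also have "real n powr (2 * h) * real n powr (2 * h) = real n powr (4 * h)" by (simp flip: powr_add)
    also have "(a' * P / k\<^sup>2) * (real n powr (4 * h) / real i) \<le> (a' * P / k\<^sup>2) * (real n powr \<eta> / real i)"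
      using i h a' P by (intro mult_left_mono divide_right_mono powr_mono) auto
    finally show ?thesis by simp
  qed
  show ?C1
  proof (rule exI, rule eventually_mono[OF eventually_ge_at_top[of 3]], intro ballI conjI)
    fix n i :: nat assume n: "3 \<le> n" and i: "i \<in> {1..n}"
    show "0 \<le> C1_tilde c \<alpha> x (alpha1 \<alpha> n) i" by (rule C12_tilde_nonneg(2)[OF n])
    show "C1_tilde c \<alpha> x (alpha1 \<alpha> n) i \<le> (2 * A * P / k\<^sup>2) * real n powr \<eta> / real i"
    proof (cases "i = 1")
      case True then show ?thesis using A P by (simp add: C1_tilde_def)
    next
      case False
      then have "2 \<le> i" "i \<le> n" using i by auto
      from key[OF this _ _ sum_psiP_w_nonneg P(2), of "2 * ln (2 / alpha1 \<alpha> n)" "2 * A"]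
      show ?thesis using False A(1) A(2)[OF n] alpha1_bounds(1)[OF \<alpha> n] by (simp add: C1_tilde_def)
    qed
  qed
  show ?C2
  proof (rule exI, rule eventually_mono[OF eventually_ge_at_top[of 3]], intro ballI conjI)
    fix n i :: nat assume n: "3 \<le> n" and i: "i \<in> {1..n}"
    show "0 \<le> C2_tilde c \<alpha> x i" by (rule C12_tilde_nonneg(1))
    show "C2_tilde c \<alpha> x i \<le> (P * P / k\<^sup>2) * real n powr \<eta> / real i"
    proof (cases "i = 1")
      case True then show ?thesis using P by (simp add: C2_tilde_def)
    next
      case False
      then have i2: "2 \<le> i" "i \<le> n" using i by auto
      have "P * real i powr h \<le> P * real n powr h" using i P h by (intro mult_left_mono powr_mono2) auto
      then have "(\<Sum>j\<in>{1..<i}. psiP (w j)) \<le> P * real n powr h" using P(2)[of i] by linarith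
      from key[OF i2 sum_psiP_w_nonneg this sum_psiP_w_nonneg P(2)]
      show ?thesis using False P(1) by (simp add: C2_tilde_def power2_eq_square)
    qed
  qed
qed

end

section \<open>The two confidence limits\<close>

text \<open>The bound on \<open>r\<close> comes from the cancellation-free form \<open>r = 2 q / (B + sqrt (B\<^sup>2 + 4 A q))\<close>.\<close>
lemma larger_quadratic_root:
  fixes A B q :: real
  assumes "A > 0" "B \<ge> 1" "0 \<le> B\<^sup>2 + 4 * A * q"
  defines "r \<equiv> (- B + sqrt (B\<^sup>2 + 4 * A * q)) / (2 * A)"
  shows "A * r\<^sup>2 + B * r = q" "\<bar>r\<bar> \<le> 2 * \<bar>q\<bar>"
proof -
  define d where "d = sqrt (B\<^sup>2 + 4 * A * q)"
  have d2: "d\<^sup>2 = B\<^sup>2 + 4 * A * q" and d0: "d \<ge> 0" using assms(3) by (auto simp: d_def)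
  have r: "2 * A * r = d - B" using assms(1) by (simp add: r_def d_def)
  have "4 * A * (A * r\<^sup>2 + B * r) = (2 * A * r)\<^sup>2 + 2 * B * (2 * A * r)"
    by (simp add: power2_eq_square algebra_simps)
  also have "\<dots> = 4 * A * q" unfolding r using d2 by (simp add: power2_eq_square algebra_simps)
  finally show eq: "A * r\<^sup>2 + B * r = q" using assms(1) by simp
  have "2 * A * (r * (B + d)) = (d - B) * (B + d)" using r by (metis mult.assoc)
  also have "\<dots> = 2 * A * (2 * q)" using d2 by (simp add: power2_eq_square algebra_simps)
  finally have "r * (B + d) = 2 * q" using assms(1) by simp
  then have "\<bar>r\<bar> * (B + d) = 2 * \<bar>q\<bar>" using assms(2) d0 by (metis abs_mult abs_numeral abs_of_nonneg add_nonneg_nonneg order_trans zero_le_one)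
  moreover have "\<bar>r\<bar> * 1 \<le> \<bar>r\<bar> * (B + d)" using assms(2) d0 by (intro mult_left_mono) auto
  ultimately show "\<bar>r\<bar> \<le> 2 * \<bar>q\<bar>" by simp
qed

context regular_path
begin

lemma upper_limit_tendsto:
  "(\<lambda>n. sqrt (real n) * (upper_limit f c \<alpha> x n - center f c \<alpha> x n \<alpha>)) \<longlonglongrightarrow> sqrt (2 * v * ln (1 / \<alpha>))"
  using radius_tendsto[of "\<lambda>_. \<alpha>"] by (simp add: upper_limit_def)

text \<open>Write \<open>r\<close> for the lower limit, \<open>A\<close>, \<open>1 + B\<close>, \<open>C\<close> for the coefficients of order two, one and zero, and
  \<open>q = D - C - R\<close>. For \<open>s > 0\<close> the averages \<open>A\<close> and \<open>B\<close> are \<open>o(1 / sqrt n)\<close> and \<open>r\<close> is bounded, so only the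
  radius survives in \<open>D - r = C + R + B r + A r\<^sup>2\<close>. For \<open>s = 0\<close>, where \<open>v = 0\<close> and the limit is \<open>0\<close>, the
  center is \<open>o(1 / sqrt n)\<close>, hence so are \<open>q\<close> and \<open>r\<close>. In both cases \<open>A q \<rightarrow> 0\<close>, so the discriminant is
  eventually positive and the value \<open>-\<infinity>\<close> does not occur.\<close>
lemma lower_limit_tendsto:
  "(\<lambda>n. ereal (sqrt (real n)) *
      (ereal (center f c \<alpha> x n (alpha2 \<alpha> n)) - lower_limit f c \<alpha> x n (alpha1 \<alpha> n) (alpha2 \<alpha> n)))
    \<longlonglongrightarrow> ereal (sqrt (2 * v * ln (1 / \<alpha>)))"
proof -
  define l where "l n = lam f c \<alpha> x n (alpha2 \<alpha> n)" for n
  define D where "D n = center f c \<alpha> x n (alpha2 \<alpha> n)" for n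
  define R where "R n = radius f c \<alpha> x n (alpha2 \<alpha> n)" for n
  define A where "A n = wavg (l n) (C2_tilde c \<alpha> x) n" for n
  define B where "B n = wavg (l n) (C1_tilde c \<alpha> x (alpha1 \<alpha> n)) n" for n
  define C where "C n = wavg (l n) (C0_tilde c \<alpha> x (alpha1 \<alpha> n)) n" for n
  define q where "q n = D n - C n - R n" for n
  define r where "r n = (- (1 + B n) + sqrt ((1 + B n)\<^sup>2 + 4 * A n * q n)) / (2 * A n)" for n
  define T where "T = sqrt (2 * v * ln (1 / \<alpha>))"
  note a2 = alpha2_tendsto[of \<alpha>]
  have lpos: "eventually (\<lambda>n. \<forall>i\<in>{1..n}. 0 < l n i) sequentially"
    unfolding l_def by (rule lam_pos[OF a2])
  have R: "(\<lambda>n. sqrt (real n) * R n) \<longlonglongrightarrow> T"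
    unfolding R_def T_def by (rule radius_tendsto[OF a2])
  have C: "(\<lambda>n. sqrt (real n) * C n) \<longlonglongrightarrow> 0"
    unfolding C_def l_def by (rule wavg_lam_tendsto_0[OF a2 C0_tilde_bound])
  have D_eq: "D n = wavg (l n) (\<lambda>i. (x i - mu_hat f c \<alpha> x i)\<^sup>2) n" for n
    by (simp add: D_def l_def center_def)
  have le_sqrt: "\<bar>y\<bar> \<le> \<bar>sqrt (real n) * y\<bar>" if "n \<ge> 1" for y and n :: nat
  proof -
    have "1 * \<bar>y\<bar> \<le> sqrt (real n) * \<bar>y\<bar>" using that by (intro mult_right_mono) auto
    then show ?thesis by (simp add: abs_mult)
  qed
  have A_pos: "eventually (\<lambda>n. 0 < A n) sequentially"
    using lpos eventually_ge_at_top[of 2]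
  proof eventually_elim
    case (elim n)
    have "0 < (\<Sum>i\<in>{1..n}. l n i)" using elim by (intro sum_pos) auto
    moreover have "0 < (\<Sum>i\<in>{1..n}. l n i * C2_tilde c \<alpha> x i)"
      using elim C12_tilde_nonneg(1) C2_tilde_pos[of 2]
      by (intro sum_pos2[of _ 2]) (auto intro!: mult_nonneg_nonneg intro: less_imp_le)
    ultimately show ?case by (simp add: A_def wavg_def)
  qed
  obtain KA where KA: "eventually (\<lambda>n. \<bar>A n\<bar> \<le> KA) sequentially"
  proof
    show "eventually (\<lambda>n. \<bar>A n\<bar> \<le> (exp (c5 c) * c5 c)\<^sup>2) sequentially"
      using lpos eventually_ge_at_top[of 1]
    proof eventually_elim
      case (elim n)
      from wavg_bounds[OF elim C12_tilde_nonneg(1) C2_tilde_le] show ?case by (simp add: A_def)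
    qed
  qed
  obtain KD where KD: "eventually (\<lambda>n. \<bar>D n\<bar> \<le> KD) sequentially"
  proof -
    obtain Y where Y: "\<And>i. i \<ge> 1 \<Longrightarrow> (x i - mu_hat f c \<alpha> x i)\<^sup>2 \<le> Y"
      by (rule residual_bounded) (rule that)
    have "eventually (\<lambda>n. \<bar>D n\<bar> \<le> Y) sequentially"
      using lpos eventually_ge_at_top[of 1]
    proof eventually_elim
      case (elim n)
      have "(x i - mu_hat f c \<alpha> x i)\<^sup>2 \<le> Y" if "i \<in> {1..n}" for i using Y that by simp
      from wavg_bounds[OF elim zero_le_power2 this] show ?case by (simp add: D_eq)
    qed
    then show ?thesis by (rule that)
  qed
  have B_nonneg: "eventually (\<lambda>n. 0 \<le> B n) sequentially"
    using lpos eventually_ge_at_top[of 3]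
  proof eventually_elim
    case (elim n)
    have "0 \<le> (\<Sum>i\<in>{1..n}. l n i * C1_tilde c \<alpha> x (alpha1 \<alpha> n) i)"
      using elim C12_tilde_nonneg(2)[OF elim(2)]
      by (intro sum_nonneg mult_nonneg_nonneg) (auto intro: less_imp_le)
    moreover have "0 \<le> (\<Sum>i\<in>{1..n}. l n i)" using elim by (intro sum_nonneg) (auto intro: less_imp_le)
    ultimately show ?case by (simp add: B_def wavg_def)
  qed
  have main: "eventually (\<lambda>n. 0 \<le> (1 + B n)\<^sup>2 + 4 * A n * q n) sequentially \<and>
     (\<lambda>n. sqrt (real n) * (D n - r n)) \<longlonglongrightarrow> T"
  proof -
    have disc: "eventually (\<lambda>n. 0 \<le> (1 + B n)\<^sup>2 + 4 * A n * q n) sequentially"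
      if Aq: "(\<lambda>n. A n * q n) \<longlonglongrightarrow> 0"
    proof -
      have "eventually (\<lambda>n. - (1 / 4) < A n * q n) sequentially"
        by (rule order_tendstoD(1)[OF Aq]) simp
      then show ?thesis using B_nonneg
      proof eventually_elim
        case (elim n)
        have "1 \<le> (1 + B n)\<^sup>2" using elim by (intro one_le_power) auto
        then show ?case unfolding mult.assoc using elim by linarith
      qed
    qed
    have root: "eventually (\<lambda>n. A n * (r n)\<^sup>2 + (1 + B n) * r n = q n \<and> \<bar>r n\<bar> \<le> 2 * \<bar>q n\<bar>) sequentially"
      if "eventually (\<lambda>n. 0 \<le> (1 + B n)\<^sup>2 + 4 * A n * q n) sequentially"
      using that A_pos B_nonneg
    proof eventually_elim
      case (elim n)
      have "1 \<le> 1 + B n" using elim by simp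
      from larger_quadratic_root[OF elim(2) this elim(1)] show ?case by (simp add: r_def)
    qed
    show ?thesis
    proof (cases "s = 0")
      case True
      have T0: "T = 0" unfolding T_def using v_eq_0_if_degenerate[OF True] by simp
      \<comment> \<open>The squared residuals are at most of order \<open>1 / i\<close>, because no randomness is left.\<close>
      have D: "(\<lambda>n. sqrt (real n) * D n) \<longlonglongrightarrow> 0"
        unfolding D_eq l_def
      proof (rule wavg_lam_tendsto_0[OF a2], intro exI eventually_sequentiallyI[of 1] ballI conjI)
        fix \<eta> :: real and n i :: nat assume \<eta>: "\<eta> > 0" and n: "1 \<le> n" and i: "i \<in> {1..n}"
        define K where "K = (\<mu> - c4 c)\<^sup>2 + (\<mu> - 1 / 2)\<^sup>2"
        show "0 \<le> (x i - mu_hat f c \<alpha> x i)\<^sup>2" by simp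
        have "1 \<le> real n powr \<eta>" using n \<eta> by (intro ge_one_powr_ge_zero) auto
        then have "K * 1 \<le> K * real n powr \<eta>" by (intro mult_left_mono) (auto simp: K_def)
        then have "K / real i \<le> K * real n powr \<eta> / real i" by (intro divide_right_mono) auto
        with residual_le_degenerate[OF True, of i] i
        show "(x i - mu_hat f c \<alpha> x i)\<^sup>2 \<le> ((\<mu> - c4 c)\<^sup>2 + (\<mu> - 1 / 2)\<^sup>2) * real n powr \<eta> / real i"
          by (simp add: K_def)
      qed
      have q: "(\<lambda>n. sqrt (real n) * q n) \<longlonglongrightarrow> 0"
        using tendsto_diff[OF tendsto_diff[OF D C] R] T0 by (simp add: q_def right_diff_distrib)
      have "(\<lambda>n. A n * q n) \<longlonglongrightarrow> 0"
      proof (rule Lim_null_comparison)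
        show "(\<lambda>n. KA * \<bar>sqrt (real n) * q n\<bar>) \<longlonglongrightarrow> 0"
          using tendsto_mult[OF tendsto_const[of KA] tendsto_rabs[OF q]] by simp
        show "eventually (\<lambda>n. norm (A n * q n) \<le> KA * \<bar>sqrt (real n) * q n\<bar>) sequentially"
          using KA eventually_ge_at_top[of 1]
        proof eventually_elim
          case (elim n)
          then show ?case unfolding real_norm_def abs_mult[of "A n"]
            by (intro mult_mono le_sqrt) auto
        qed
      qed
      note disc = disc[OF this]
      have "(\<lambda>n. sqrt (real n) * r n) \<longlonglongrightarrow> 0"
      proof (rule Lim_null_comparison)
        show "(\<lambda>n. 2 * \<bar>sqrt (real n) * q n\<bar>) \<longlonglongrightarrow> 0"
          using tendsto_mult[OF tendsto_const[of 2] tendsto_rabs[OF q]] by simp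
        show "eventually (\<lambda>n. norm (sqrt (real n) * r n) \<le> 2 * \<bar>sqrt (real n) * q n\<bar>) sequentially"
          using root[OF disc]
        proof eventually_elim
          case (elim n)
          have "sqrt (real n) * \<bar>r n\<bar> \<le> sqrt (real n) * (2 * \<bar>q n\<bar>)" using elim by (intro mult_left_mono) auto
          then show ?case by (simp add: abs_mult)
        qed
      qed
      from tendsto_diff[OF D this] have "(\<lambda>n. sqrt (real n) * (D n - r n)) \<longlonglongrightarrow> T"
        by (simp add: T0 right_diff_distrib)
      with disc show ?thesis by blast
    next
      case False
      then have s: "s > 0" using s_nonneg by simp
      have A: "(\<lambda>n. sqrt (real n) * A n) \<longlonglongrightarrow> 0"
        unfolding A_def l_def by (rule wavg_lam_tendsto_0[OF a2 C12_tilde_bound(2)[OF s]])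
      have B: "(\<lambda>n. sqrt (real n) * B n) \<longlonglongrightarrow> 0"
        unfolding B_def l_def by (rule wavg_lam_tendsto_0[OF a2 C12_tilde_bound(1)[OF s]])
      have qb: "eventually (\<lambda>n. \<bar>q n\<bar> \<le> KD + 1 + (\<bar>T\<bar> + 1)) sequentially"
      proof -
        have "eventually (\<lambda>n. \<bar>sqrt (real n) * C n\<bar> < 1) sequentially"
          by (rule order_tendstoD(2)[OF tendsto_rabs[OF C]]) simp
        moreover have "eventually (\<lambda>n. \<bar>sqrt (real n) * R n\<bar> < \<bar>T\<bar> + 1) sequentially"
          by (rule order_tendstoD(2)[OF tendsto_rabs[OF R]]) simp
        ultimately show ?thesis using KD eventually_ge_at_top[of 1]
        proof eventually_elim
          case (elim n)
          with le_sqrt[OF elim(4), of "C n"] le_sqrt[OF elim(4), of "R n"] show ?case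
            unfolding q_def by linarith
        qed
      qed
      define K where "K = KD + 1 + (\<bar>T\<bar> + 1)"
      have "(\<lambda>n. A n * q n) \<longlonglongrightarrow> 0"
      proof (rule Lim_null_comparison)
        show "(\<lambda>n. \<bar>sqrt (real n) * A n\<bar> * K) \<longlonglongrightarrow> 0"
          using tendsto_mult[OF tendsto_rabs[OF A] tendsto_const[of K]] by simp
        show "eventually (\<lambda>n. norm (A n * q n) \<le> \<bar>sqrt (real n) * A n\<bar> * K) sequentially"
          using qb eventually_ge_at_top[of 1]
        proof eventually_elim
          case (elim n)
          then show ?case unfolding real_norm_def abs_mult[of "A n"] K_def
            by (intro mult_mono le_sqrt) auto
        qed
      qed
      note disc = disc[OF this]
      have rb: "eventually (\<lambda>n. \<bar>r n\<bar> \<le> 2 * K) sequentially"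
        using root[OF disc] qb by eventually_elim (auto simp: K_def)
      have Br: "(\<lambda>n. sqrt (real n) * B n * r n) \<longlonglongrightarrow> 0"
      proof (rule Lim_null_comparison)
        show "(\<lambda>n. \<bar>sqrt (real n) * B n\<bar> * (2 * K)) \<longlonglongrightarrow> 0"
          using tendsto_mult[OF tendsto_rabs[OF B] tendsto_const[of "2 * K"]] by simp
        show "eventually (\<lambda>n. norm (sqrt (real n) * B n * r n) \<le> \<bar>sqrt (real n) * B n\<bar> * (2 * K)) sequentially"
          using rb
        proof eventually_elim
          case (elim n)
          then show ?case unfolding real_norm_def abs_mult[of _ "r n"]
            by (intro mult_left_mono) auto
        qed
      qed
      have Ar: "(\<lambda>n. sqrt (real n) * A n * (r n)\<^sup>2) \<longlonglongrightarrow> 0"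
      proof (rule Lim_null_comparison)
        show "(\<lambda>n. \<bar>sqrt (real n) * A n\<bar> * (2 * K)\<^sup>2) \<longlonglongrightarrow> 0"
          using tendsto_mult[OF tendsto_rabs[OF A] tendsto_const[of "(2 * K)\<^sup>2"]] by simp
        show "eventually (\<lambda>n. norm (sqrt (real n) * A n * (r n)\<^sup>2) \<le> \<bar>sqrt (real n) * A n\<bar> * (2 * K)\<^sup>2) sequentially"
          using rb
        proof eventually_elim
          case (elim n)
          have "\<bar>r n\<bar>\<^sup>2 \<le> (2 * K)\<^sup>2" using elim by (intro power_mono) auto
          then show ?case unfolding real_norm_def abs_mult[of _ "(r n)\<^sup>2"]
            by (intro mult_left_mono) auto
        qed
      qed
      have "(\<lambda>n. sqrt (real n) * C n + sqrt (real n) * R n + sqrt (real n) * B n * r n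
          + sqrt (real n) * A n * (r n)\<^sup>2) \<longlonglongrightarrow> 0 + T + 0 + 0"
        by (intro tendsto_add C R Br Ar)
      then have "(\<lambda>n. sqrt (real n) * C n + sqrt (real n) * R n + sqrt (real n) * B n * r n
          + sqrt (real n) * A n * (r n)\<^sup>2) \<longlonglongrightarrow> T" by simp
      moreover have "eventually (\<lambda>n. sqrt (real n) * C n + sqrt (real n) * R n + sqrt (real n) * B n * r n
          + sqrt (real n) * A n * (r n)\<^sup>2 = sqrt (real n) * (D n - r n)) sequentially"
        using root[OF disc]
      proof eventually_elim
        case (elim n)
        then have "D n - r n = C n + R n + B n * r n + A n * (r n)\<^sup>2"
          by (simp add: q_def algebra_simps)
        then show ?case by (simp add: distrib_left mult.assoc)
      qed
      ultimately have "(\<lambda>n. sqrt (real n) * (D n - r n)) \<longlonglongrightarrow> T" by (rule Lim_transform_eventually)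
      with disc show ?thesis by blast
    qed
  qed
  then have "(\<lambda>n. ereal (sqrt (real n) * (D n - r n))) \<longlonglongrightarrow> ereal T" by (simp add: tendsto_ereal)
  moreover have "eventually (\<lambda>n. ereal (sqrt (real n) * (D n - r n)) = ereal (sqrt (real n)) *
      (ereal (D n) - lower_limit f c \<alpha> x n (alpha1 \<alpha> n) (alpha2 \<alpha> n))) sequentially"
    using main[THEN conjunct1]
  proof eventually_elim
    case (elim n)
    then have "lower_limit f c \<alpha> x n (alpha1 \<alpha> n) (alpha2 \<alpha> n) = ereal (r n)"
      unfolding lower_limit_def Let_def r_def q_def A_def B_def C_def D_def R_def l_def by simp
    then show ?case by simp
  qed
  ultimately show ?thesis unfolding T_def[symmetric] D_def[symmetric] by (rule Lim_transform_eventually)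
qed

end

theorem corollary4p8:
  fixes M :: "'a measure"
    and X :: "nat \<Rightarrow> 'a \<Rightarrow> real"
    and \<mu> \<sigma>2 v \<alpha> :: real
    and c :: tuning
    and f :: mean_form
  assumes "prob_space M"
    and "\<And>t. t \<ge> 1 \<Longrightarrow> X t \<in> borel_measurable M"
    and "\<And>t. t \<ge> 1 \<Longrightarrow> AE w in M. X t w \<in> {0..1}"
    and "\<And>t. t \<ge> 1 \<Longrightarrow> AE w in M. real_cond_exp M (hist M X (t - 1)) (X t) w = \<mu>"
    and "\<And>t. t \<ge> 1 \<Longrightarrow> AE w in M. cond_var M (hist M X (t - 1)) (X t) w = \<sigma>2"
    and "\<And>t. t \<ge> 1 \<Longrightarrow> AE w in M. cond_var M (hist M X (t - 1)) (\<lambda>w. (X t w - \<mu>)\<^sup>2) w = v"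
    and "0 < \<alpha>" and "\<alpha> < 1"
    and "admissible c"
  shows "AE w in M.
      (\<lambda>n. sqrt (real n) *
             (upper_limit f c \<alpha> (\<lambda>i. X i w) n - center f c \<alpha> (\<lambda>i. X i w) n \<alpha>))
        \<longlonglongrightarrow> sqrt (2 * v * ln (1 / \<alpha>))
    \<and> (\<lambda>n. ereal (sqrt (real n)) *
             (ereal (center f c \<alpha> (\<lambda>i. X i w) n (alpha2 \<alpha> n))
              - lower_limit f c \<alpha> (\<lambda>i. X i w) n (alpha1 \<alpha> n) (alpha2 \<alpha> n)))
        \<longlonglongrightarrow> ereal (sqrt (2 * v * ln (1 / \<alpha>)))"
proof -
  interpret prob_space M by fact
  note Xm = assms(2) and X01 = assms(3)
  \<comment> \<open>A conditional variance is a conditional mean, once the inner conditional mean is replaced by the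
    constant that it almost surely equals.\<close>
  have centred: "AE w in M. real_cond_exp M (hist M X (t - 1)) (\<lambda>w. (g (X t w) - m)\<^sup>2) w = u"
    if t: "t \<ge> 1" and g: "g \<in> borel_measurable borel"
      and m: "AE w in M. real_cond_exp M (hist M X (t - 1)) (\<lambda>w. g (X t w)) w = m"
      and u: "AE w in M. cond_var M (hist M X (t - 1)) (\<lambda>w. g (X t w)) w = u" for t g m u
  proof -
    interpret sub: finite_measure_subalgebra M "hist M X (t - 1)"
      by unfold_locales (rule subalgebra_hist[OF Xm])
    have gX: "(\<lambda>w. g (X t w)) \<in> borel_measurable M" using Xm[OF t] g by measurable
    have "AE w in M. real_cond_exp M (hist M X (t - 1))
          (\<lambda>w. (g (X t w) - real_cond_exp M (hist M X (t - 1)) (\<lambda>w. g (X t w)) w)\<^sup>2) w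
        = real_cond_exp M (hist M X (t - 1)) (\<lambda>w. (g (X t w) - m)\<^sup>2) w"
    proof (rule sub.real_cond_exp_cong)
      show "AE w in M. (g (X t w) - real_cond_exp M (hist M X (t - 1)) (\<lambda>w. g (X t w)) w)\<^sup>2
          = (g (X t w) - m)\<^sup>2"
        using m by eventually_elim simp
    qed (use gX in measurable)
    with u show ?thesis unfolding cond_var_def by eventually_elim simp
  qed
  have e1: "AE w in M. real_cond_exp M (hist M X (t - 1)) (\<lambda>w. X t w) w = \<mu>" if "t \<ge> 1" for t
    using assms(4)[OF that] by simp
  have e2: "AE w in M. real_cond_exp M (hist M X (t - 1)) (\<lambda>w. (X t w - \<mu>)\<^sup>2) w = \<sigma>2" if "t \<ge> 1" for t
    using centred[OF that, of "\<lambda>x. x"] e1[OF that] assms(5)[OF that] by simp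
  have e4: "AE w in M. real_cond_exp M (hist M X (t - 1)) (\<lambda>w. ((X t w - \<mu>)\<^sup>2 - \<sigma>2)\<^sup>2) w = v" if "t \<ge> 1" for t
    using centred[OF that, of "\<lambda>x. (x - \<mu>)\<^sup>2"] e2[OF that] assms(6)[OF that] by simp
  have b1: "\<bar>x - \<mu>\<bar> \<le> 1 + \<bar>\<mu>\<bar>" if "x \<in> {0..1}" for x :: real using that by auto
  have b2: "\<bar>(x - \<mu>)\<^sup>2\<bar> \<le> (1 + \<bar>\<mu>\<bar>)\<^sup>2" if "x \<in> {0..1}" for x :: real
    using power_mono[OF b1[OF that], of 2] by simp
  have b4: "\<bar>((x - \<mu>)\<^sup>2 - \<sigma>2)\<^sup>2\<bar> \<le> ((1 + \<bar>\<mu>\<bar>)\<^sup>2 + \<bar>\<sigma>2\<bar>)\<^sup>2" if "x \<in> {0..1}" for x :: real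
  proof -
    have "\<bar>(x - \<mu>)\<^sup>2 - \<sigma>2\<bar> \<le> (1 + \<bar>\<mu>\<bar>)\<^sup>2 + \<bar>\<sigma>2\<bar>" using b2[OF that] by linarith
    from power_mono[OF this, of 2] show ?thesis by simp
  qed
  have m1: "AE w in M. poly_null (\<lambda>n. (\<Sum>i\<in>{1..<n}. X i w - \<mu>) / real n)"
    by (rule const_cond_mean_average_poly_null[where g = "\<lambda>x. x" and B = 1, OF Xm X01 _ _ e1]) auto
  have m2: "AE w in M. poly_null (\<lambda>n. (\<Sum>i\<in>{1..<n}. (X i w - \<mu>)\<^sup>2 - \<sigma>2) / real n)"
    by (rule const_cond_mean_average_poly_null[where g = "\<lambda>x. (x - \<mu>)\<^sup>2", OF Xm X01 _ b2 e2]) auto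
  have m4: "AE w in M. poly_null (\<lambda>n. (\<Sum>i\<in>{1..<n}. ((X i w - \<mu>)\<^sup>2 - \<sigma>2)\<^sup>2 - v) / real n)"
    by (rule const_cond_mean_average_poly_null[where g = "\<lambda>x. ((x - \<mu>)\<^sup>2 - \<sigma>2)\<^sup>2", OF Xm X01 _ b4 e4]) auto
  \<comment> \<open>The expectation of \<open>(X t - \<mu>)\<^sup>2\<close> is that of its conditional mean \<open>\<sigma>2\<close>.\<close>
  have deg: "AE w in M. \<sigma>2 = 0 \<longrightarrow> X t w = \<mu>" if t: "t \<ge> 1" for t
  proof (cases "\<sigma>2 = 0")
    case True
    interpret sub: finite_measure_subalgebra M "hist M X (t - 1)"
      by unfold_locales (rule subalgebra_hist[OF Xm])
    have Ym: "(\<lambda>w. (X t w - \<mu>)\<^sup>2) \<in> borel_measurable M" using Xm[OF t] by measurable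
    have int: "integrable M (\<lambda>w. (X t w - \<mu>)\<^sup>2)"
    proof (rule integrable_const_bound[OF _ Ym])
      show "AE w in M. norm ((X t w - \<mu>)\<^sup>2) \<le> (1 + \<bar>\<mu>\<bar>)\<^sup>2"
        using X01[OF t] by eventually_elim (use b2 in simp)
    qed
    have "expectation (\<lambda>w. (X t w - \<mu>)\<^sup>2) = expectation (real_cond_exp M (hist M X (t - 1)) (\<lambda>w. (X t w - \<mu>)\<^sup>2))"
      by (rule sub.real_cond_exp_int(2)[OF int, symmetric])
    also have "\<dots> = expectation (\<lambda>_. 0)"
      by (rule integral_cong_AE) (use e2[OF t] True in auto)
    finally have "AE w in M. (X t w - \<mu>)\<^sup>2 = 0"
      using integral_nonneg_eq_0_iff_AE[OF int] by simp
    then show ?thesis by eventually_elim simp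
  qed simp
  have X01': "AE w in M. \<forall>t\<in>{1..}. X t w \<in> {0..1}" by (intro AE_ball_countable') (use X01 in auto)
  have deg': "AE w in M. \<forall>t\<in>{1..}. \<sigma>2 = 0 \<longrightarrow> X t w = \<mu>" by (intro AE_ball_countable') (use deg in auto)
  from X01' deg' m1 m2 m4 show ?thesis
  proof eventually_elim
    case (elim w)
    interpret regular_path "\<lambda>i. X i w" c f \<alpha> \<mu> \<sigma>2 v
      by unfold_locales (use elim assms in auto)
    show ?case using upper_limit_tendsto lower_limit_tendsto by blast
  qed
qed

end
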